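(* Let $\Phi$ be a TD system on $V$ of $q$-Racah type with diameter $d\ge1$ and associated nonzero scalars $q,a,b\in\mathbb{K}$, and let $B,R^\Downarrow,\psi\in\mathrm{End}(V)$ be the associated linear transformations. Then there exists a $U_q(\mathfrak{sl}_2)$-module structure on $V$ for which the Chevalley generators $e,f,k,k^{-1}$ act on $V$ as $$e\mapsto (q-q^{-1})^{-1}\psi,\qquad f\mapsto (q-q^{-1})^{-1}R^\Downarrow,\qquad k\mapsto B,\qquad k^{-1}\mapsto B^{-1}.$$
   Context: Let $\mathbb{K}$ be an algebraically closed field, $V$ a nonzero finite-dimensional $\mathbb{K}$-vector space, $\mathrm{End}(V)$ the algebra of linear maps $V\to V$, and $I$ the identity. TD pairs and systems. A tridiagonal (TD) pair on $V$ is an ordered pair $A,A^*\in\mathrm{End}(V)$ such that: (i) each of $A,A^*$ is diagonalizable; (ii) there is an ordering $\{V_i\}_{i=0}^d$ of the eigenspaces of $A$ with $A^*V_i\subseteq V_{i-1}+V_i+V_{i+1}$ for $0\le i\le d$ ($V_{-1}=V_{d+1}=0$); (iii) there is an ordering $\{V_i^*\}_{i=0}^\delta$ of the eigenspaces of $A^*$ with $AV_i^*\subseteq V_{i-1}^*+V_i^*+V_{i+1}^*$ for $0\le i\le \delta$ ($V^*_{-1}=V^*_{\delta+1}=0$); (iv) there is no subspace $W$ with $AW\subseteq W$, $A^*W\subseteq W$, $W\ne0$, $W\neq V$. It is known that $d=\delta$ (the diameter); assume $d\ge1$. Orderings as in (ii), (iii) are called standard. The primitive idempotent for an eigenspace of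 a diagonalizable map is the projection onto it along the sum of the other eigenspaces; an ordering of the primitive idempotents is standard if the corresponding ordering of eigenspaces is. A TD system on $V$ is a sequence $\Phi=(A;\{E_i\}_{i=0}^d;A^*;\{E_i^*\}_{i=0}^d)$ where $A,A^*$ is a TD pair on $V$ and $\{E_i\}$ (resp. $\{E_i^*\}$) is a standard ordering of the primitive idempotents of $A$ (resp. $A^*$). Let $\theta_i$ (resp. $\theta_i^*$) be the eigenvalue of $A$ (resp. $A^*$) for $E_i$ (resp. $E_i^*$). $\Phi$ has $q$-Racah type, with scalars $q,a,b$, if $q,a,b\in\mathbb{K}$ are nonzero, $q^4\ne1$, and $\theta_i=aq^{d-2i}+a^{-1}q^{2i-d}$, $\theta_i^*=bq^{d-2i}+b^{-1}q^{2i-d}$ for $0\le i\le d$. Split decompositions. For $0\le i\le d$ let $U_i=(E_0^*V+\cdots+E_i^*V)\cap(E_iV+\cdots+E_dV)$ and $U_i^\Downarrow=(E_0^*V+\cdots+E_i^*V)\cap(E_0V+\cdots+E_{d-i}V)$. It is known that $V=\bigoplus_{i=0}^dU_i=\bigoplus_{i=0}^dU_i^\Downarrow$, with all summands nonzero. For $0\le i\le d/2$ let $K_i=(E_0^*V+\cdots+E_i^*V)\cap(E_iV+\cdots+E_{d-i}V)=U_i\cap U_i^\Downarrow$. The maps. $K\in\mathrm{End}(V)$ acts on $U_i$ as $q^{d-2i}I$, and $B\in\mathrm{End}(V)$ acts on $U_i^\Downarrow$ as $q^{d-2i}I$, for $0\le i\le d$; both are invertible. Put $R=A-aK-a^{-1}K^{-1}$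 and $R^\Downarrow=A-a^{-1}B-aB^{-1}$. The map $\psi$ is the element of $\mathrm{End}(V)$, known to exist and be unique, such that $\psi R-R\psi=(q-q^{-1})(K-K^{-1})$ and $\psi K_i=0$ for $0\le i\le d/2$. $U_q(\mathfrak{sl}_2)$ is the unital associative $\mathbb{K}$-algebra with generators $e,f,k,k^{-1}$ (Chevalley generators) and relations $kk^{-1}=k^{-1}k=1$, $kek^{-1}=q^2e$, $kfk^{-1}=q^{-2}f$, $ef-fe=\frac{k-k^{-1}}{q-q^{-1}}$. *)

theory Defs
  imports
    "HOL-Library.Poly_Mapping"
    "HOL-Algebra.QuotRing"
    "HOL-Algebra.Algebraic_Closure_Type"
begin

section \<open>Tridiagonal pairs and tridiagonal systems\<close>

text \<open>
  The underlying vector space \<open>V\<close> is the whole type \<open>'b\<close>, and \<open>End(V)\<close> consists of the functions \<open>f\<close> with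
  \<open>Vector_Spaces.linear scale scale f\<close>. Finite sequences indexed by \<open>0,\<dots>,d\<close> are functions on
  \<open>nat\<close> of which only the values at \<open>i \<le> d\<close> are used.
\<close>

locale td_space = finite_dimensional_vector_space scale Basis
  for scale :: "'a::alg_closed_field \<Rightarrow> 'b::ab_group_add \<Rightarrow> 'b" and Basis :: "'b set" +
  assumes nonzero: "(UNIV :: 'b set) \<noteq> {0}"
begin

definition eigenspace :: "('b \<Rightarrow> 'b) \<Rightarrow> 'a \<Rightarrow> 'b set" where
  "eigenspace A \<theta> = {v. A v = scale \<theta> v}"

definition eigenspaces :: "('b \<Rightarrow> 'b) \<Rightarrow> 'b set set" where
  "eigenspaces A = {eigenspace A \<theta> | \<theta>. eigenspace A \<theta> \<noteq> {0}}"

definition diagonalizable :: "('b \<Rightarrow> 'b) \<Rightarrow> bool" where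
  "diagonalizable A \<longleftrightarrow>
     (\<exists>S. independent S \<and> span S = UNIV \<and> (\<forall>v\<in>S. \<exists>\<theta>. A v = scale \<theta> v))"

definition subspace_sum :: "(nat \<Rightarrow> 'b set) \<Rightarrow> nat set \<Rightarrow> 'b set" where
  "subspace_sum W J = span (\<Union>j\<in>J. W j)"

text \<open>The index set below drops \<open>-1\<close> and \<open>d+1\<close>, in accordance with \<open>V\<^sub>-\<^sub>1 = V\<^sub>d\<^sub>+\<^sub>1 = 0\<close>.\<close>

definition standard_ordering :: "('b \<Rightarrow> 'b) \<Rightarrow> ('b \<Rightarrow> 'b) \<Rightarrow> nat \<Rightarrow> (nat \<Rightarrow> 'b set) \<Rightarrow> bool" where
  "standard_ordering A As d W \<longleftrightarrow>
     bij_betw W {0..d} (eigenspaces A) \<and>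
     (\<forall>i\<le>d. As ` W i \<subseteq> subspace_sum W {j. j \<le> d \<and> i \<le> j + 1 \<and> j \<le> i + 1})"

definition td_pair :: "('b \<Rightarrow> 'b) \<Rightarrow> ('b \<Rightarrow> 'b) \<Rightarrow> bool" where
  "td_pair A As \<longleftrightarrow>
     Vector_Spaces.linear scale scale A \<and> Vector_Spaces.linear scale scale As \<and>
     diagonalizable A \<and> diagonalizable As \<and>
     (\<exists>d W. standard_ordering A As d W) \<and>
     (\<exists>\<delta> Ws. standard_ordering As A \<delta> Ws) \<and>
     \<not> (\<exists>W. subspace W \<and> A ` W \<subseteq> W \<and> As ` W \<subseteq> W \<and> W \<noteq> {0} \<and> W \<noteq> UNIV)"

definition primitive_idempotent :: "('b \<Rightarrow> 'b) \<Rightarrow> 'b set \<Rightarrow> ('b \<Rightarrow> 'b) \<Rightarrow> bool" where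
  "primitive_idempotent A W E \<longleftrightarrow>
     Vector_Spaces.linear scale scale E \<and> W \<in> eigenspaces A \<and>
     (\<forall>v\<in>W. E v = v) \<and>
     (\<forall>W'\<in>eigenspaces A - {W}. \<forall>v\<in>W'. E v = 0)"

definition standard_idempotents ::
    "('b \<Rightarrow> 'b) \<Rightarrow> ('b \<Rightarrow> 'b) \<Rightarrow> nat \<Rightarrow> (nat \<Rightarrow> 'b \<Rightarrow> 'b) \<Rightarrow> bool" where
  "standard_idempotents A As d E \<longleftrightarrow>
     (\<exists>W. standard_ordering A As d W \<and> (\<forall>i\<le>d. primitive_idempotent A (W i) (E i)))"

definition td_system ::
    "nat \<Rightarrow> ('b \<Rightarrow> 'b) \<Rightarrow> (nat \<Rightarrow> 'b \<Rightarrow> 'b) \<Rightarrow> ('b \<Rightarrow> 'b) \<Rightarrow> (nat \<Rightarrow> 'b \<Rightarrow> 'b) \<Rightarrow> bool" where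
  "td_system d A E As Es \<longleftrightarrow>
     td_pair A As \<and> standard_idempotents A As d E \<and> standard_idempotents As A d Es"

text \<open>The eigenvalue of \<open>A\<close> for the primitive idempotent \<open>E\<close>.\<close>

definition idempotent_eigenvalue :: "('b \<Rightarrow> 'b) \<Rightarrow> ('b \<Rightarrow> 'b) \<Rightarrow> 'a" where
  "idempotent_eigenvalue A E = (THE \<theta>. range E = eigenspace A \<theta>)"

definition q_racah_type ::
    "nat \<Rightarrow> ('b \<Rightarrow> 'b) \<Rightarrow> (nat \<Rightarrow> 'b \<Rightarrow> 'b) \<Rightarrow> ('b \<Rightarrow> 'b) \<Rightarrow> (nat \<Rightarrow> 'b \<Rightarrow> 'b)
      \<Rightarrow> 'a \<Rightarrow> 'a \<Rightarrow> 'a \<Rightarrow> bool" where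
  "q_racah_type d A E As Es q a b \<longleftrightarrow>
     q \<noteq> 0 \<and> a \<noteq> 0 \<and> b \<noteq> 0 \<and> q ^ 4 \<noteq> 1 \<and>
     (\<forall>i\<le>d. idempotent_eigenvalue A (E i) =
        a * q powi (int d - 2 * int i) + inverse a * q powi (2 * int i - int d)) \<and>
     (\<forall>i\<le>d. idempotent_eigenvalue As (Es i) =
        b * q powi (int d - 2 * int i) + inverse b * q powi (2 * int i - int d))"


section \<open>Split decompositions and associated maps\<close>

definition split_U ::
    "nat \<Rightarrow> (nat \<Rightarrow> 'b \<Rightarrow> 'b) \<Rightarrow> (nat \<Rightarrow> 'b \<Rightarrow> 'b) \<Rightarrow> nat \<Rightarrow> 'b set" where
  "split_U d E Es i =
     subspace_sum (\<lambda>j. range (Es j)) {0..i} \<inter> subspace_sum (\<lambda>j. range (E j)) {i..d}"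

definition split_U_down ::
    "nat \<Rightarrow> (nat \<Rightarrow> 'b \<Rightarrow> 'b) \<Rightarrow> (nat \<Rightarrow> 'b \<Rightarrow> 'b) \<Rightarrow> nat \<Rightarrow> 'b set" where
  "split_U_down d E Es i =
     subspace_sum (\<lambda>j. range (Es j)) {0..i} \<inter> subspace_sum (\<lambda>j. range (E j)) {0..d - i}"

definition split_K ::
    "nat \<Rightarrow> (nat \<Rightarrow> 'b \<Rightarrow> 'b) \<Rightarrow> (nat \<Rightarrow> 'b \<Rightarrow> 'b) \<Rightarrow> nat \<Rightarrow> 'b set" where
  "split_K d E Es i =
     subspace_sum (\<lambda>j. range (Es j)) {0..i} \<inter> subspace_sum (\<lambda>j. range (E j)) {i..d - i}"

text \<open>For \<open>U\<close> a decomposition of \<open>V\<close> there is exactly one such \<open>T\<close>.\<close>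

definition weight_map :: "'a \<Rightarrow> nat \<Rightarrow> (nat \<Rightarrow> 'b set) \<Rightarrow> ('b \<Rightarrow> 'b) \<Rightarrow> bool" where
  "weight_map q d U T \<longleftrightarrow>
     Vector_Spaces.linear scale scale T \<and>
     (\<forall>i\<le>d. \<forall>u\<in>U i. T u = scale (q powi (int d - 2 * int i)) u)"

text \<open>
  The inverse in \<open>End(V)\<close> of a map is written \<open>inv_into UNIV\<close> throughout, since the usual
  notation is also used by \<open>HOL-Algebra\<close>. With the scalar \<open>c\<close>, this is \<open>A - c T - c\<^sup>-\<^sup>1 T\<^sup>-\<^sup>1\<close>; hence
  \<open>R\<close> arises from \<open>c = a\<close> and \<open>T = K\<close>, and \<open>R\<^sup>\<Down>\<close> from \<open>c = a\<^sup>-\<^sup>1\<close> and \<open>T = B\<close>.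
\<close>

definition raising_map :: "('b \<Rightarrow> 'b) \<Rightarrow> 'a \<Rightarrow> ('b \<Rightarrow> 'b) \<Rightarrow> 'b \<Rightarrow> 'b" where
  "raising_map A c T = (\<lambda>v. A v - scale c (T v) - scale (inverse c) (inv_into UNIV T v))"

text \<open>This determines \<open>\<psi>\<close> uniquely when \<open>K\<close> and \<open>R\<close> come from a TD system of \<open>q\<close>-Racah type.\<close>

definition is_psi ::
    "'a \<Rightarrow> nat \<Rightarrow> (nat \<Rightarrow> 'b \<Rightarrow> 'b) \<Rightarrow> (nat \<Rightarrow> 'b \<Rightarrow> 'b) \<Rightarrow> ('b \<Rightarrow> 'b) \<Rightarrow> ('b \<Rightarrow> 'b)
      \<Rightarrow> ('b \<Rightarrow> 'b) \<Rightarrow> bool" where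
  "is_psi q d E Es K R \<psi> \<longleftrightarrow>
     Vector_Spaces.linear scale scale \<psi> \<and>
     (\<forall>v. \<psi> (R v) - R (\<psi> v) = scale (q - inverse q) (K v - inv_into UNIV K v)) \<and>
     (\<forall>i. 2 * i \<le> d \<longrightarrow> (\<forall>v\<in>split_K d E Es i. \<psi> v = 0))"

end


section \<open>The algebra $U_q(\mathfrak{sl}_2)$ and its modules\<close>

datatype 'g word = Word (letters: "'g list")

instantiation word :: (type) monoid_add
begin

definition zero_word :: "'a word" where
  "zero_word = Word []"

definition plus_word :: "'a word \<Rightarrow> 'a word \<Rightarrow> 'a word" where
  "plus_word u v = Word (letters u @ letters v)"

instance
  by standard (simp_all add: zero_word_def plus_word_def)

end

datatype uq_gen = Gen_e | Gen_f | Gen_k | Gen_kinv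

text \<open>
  The monoid algebra of the free monoid on the generators, with the convolution product of
  \<open>HOL-Library.Poly_Mapping\<close>, is the free unital associative algebra on the generators.
\<close>

type_synonym 'a uq_free = "uq_gen word \<Rightarrow>\<^sub>0 'a"

definition free_gen :: "uq_gen \<Rightarrow> 'a::field uq_free" where
  "free_gen g = Poly_Mapping.single (Word [g]) 1"

definition free_scalar :: "'a::field \<Rightarrow> 'a uq_free" where
  "free_scalar c = Poly_Mapping.single 0 c"

definition uq_relators :: "'a::field \<Rightarrow> 'a uq_free set" where
  "uq_relators q =
     (let e = free_gen Gen_e; f = free_gen Gen_f; k = free_gen Gen_k; k' = free_gen Gen_kinv
      in {k * k' - 1,
          k' * k - 1,
          k * e * k' - free_scalar (q ^ 2) * e,
          k * f * k' - free_scalar (inverse (q ^ 2)) * f,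
          e * f - f * e - free_scalar (inverse (q - inverse q)) * (k - k')})"

definition uq_ideal :: "'a::field \<Rightarrow> 'a uq_free set" where
  "uq_ideal q = genideal ring_of_type_algebra (uq_relators q)"

definition uq_sl2 :: "'a::field \<Rightarrow> 'a uq_free set ring" where
  "uq_sl2 q = ring_of_type_algebra Quot uq_ideal q"

definition uq_class :: "'a::field \<Rightarrow> 'a uq_free \<Rightarrow> 'a uq_free set" where
  "uq_class q x = a_r_coset ring_of_type_algebra (uq_ideal q) x"

text \<open>
  A left module over the \<open>\<bbbK>\<close>-algebra $U_q(\mathfrak{sl}_2)$ whose underlying \<open>\<bbbK>\<close>-vector space is
  the given one. The last clause expresses that the scalars of the algebra act as those of \<open>V\<close>.
\<close>

definition (in td_space) uq_module :: "'a \<Rightarrow> ('a uq_free set \<Rightarrow> 'b \<Rightarrow> 'b) \<Rightarrow> bool" where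
  "uq_module q act \<longleftrightarrow>
     (\<forall>x\<in>carrier (uq_sl2 q). Vector_Spaces.linear scale scale (act x)) \<and>
     (\<forall>x\<in>carrier (uq_sl2 q). \<forall>y\<in>carrier (uq_sl2 q). \<forall>v.
        act (x \<oplus>\<^bsub>uq_sl2 q\<^esub> y) v = act x v + act y v) \<and>
     (\<forall>x\<in>carrier (uq_sl2 q). \<forall>y\<in>carrier (uq_sl2 q). \<forall>v.
        act (x \<otimes>\<^bsub>uq_sl2 q\<^esub> y) v = act x (act y v)) \<and>
     (\<forall>v. act \<one>\<^bsub>uq_sl2 q\<^esub> v = v) \<and>
     (\<forall>c v. act (uq_class q (free_scalar c)) v = scale c v)"

lemma ring_of_type_algebra_ring: "ring (ring_of_type_algebra :: 'a::ring_1 ring)"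
proof -
  have "\<exists>y. x + y = 0" for x :: 'a
    using add.right_inverse by blast
  thus ?thesis
    unfolding ring_of_type_algebra_def using add.right_inverse
    by unfold_locales (auto simp: algebra_simps Units_def)
qed

lemma uq_sl2_ring: "ring (uq_sl2 q)"
proof -
  interpret ring "ring_of_type_algebra :: 'a uq_free ring"
    by (rule ring_of_type_algebra_ring)
  have "ideal (uq_ideal q) ring_of_type_algebra"
    unfolding uq_ideal_def by (rule genideal_ideal) (simp add: ring_of_type_algebra_def)
  then show ?thesis
    unfolding uq_sl2_def by (rule ideal.quotient_is_ring)
qed

end

theory Submission
  imports Defs
begin

text \<open>
  Put \<open>\<theta>\<^sub>i = a q\<^sup>d\<^sup>-\<^sup>2\<^sup>i + a\<^sup>-\<^sup>1 q\<^sup>2\<^sup>i\<^sup>-\<^sup>d\<close>. A module structure amounts to operators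
  satisfying the defining relations (\<open>uq_module_of_relations\<close>), so three identities have to be
  shown: \<open>B \<psi> = q\<^sup>2 \<psi> B\<close>,
  \<open>B R\<^sup>\<Down> = q\<^sup>-\<^sup>2 R\<^sup>\<Down> B\<close> and \<open>\<psi> R\<^sup>\<Down> - R\<^sup>\<Down> \<psi> = (q - q\<^sup>-\<^sup>1) (B - B\<^sup>-\<^sup>1)\<close>. The map \<open>\<psi>\<close> is given through
  its relations with \<open>K\<close> and \<open>R\<close>, that is, with the other split decomposition \<open>U\<^sub>0, \<dots>, U\<^sub>d\<close>. The idea
  is to write down an operator \<open>C\<close> in terms of \<open>K\<close> and \<open>\<psi>\<close> for which the three relations are formal
  consequences of what is known about \<open>K\<close> and \<open>\<psi>\<close>, and to identify \<open>C\<close> with \<open>B\<close> afterwards. The right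
  choice is \<open>C = (I - a\<^sup>-\<^sup>1 q \<psi>)\<^sup>-\<^sup>1 (I - a q \<psi>) K\<close>.

  The input from tridiagonal pairs is the following. The intersection of \<open>E\<^sub>0\<^sup>*V + \<dots> + E\<^sub>i\<^sup>*V\<close> and
  \<open>E\<^sub>jV + \<dots> + E\<^sub>dV\<close> vanishes for \<open>i < j\<close> (\<open>V_eq_zero\<close>), and the \<open>U\<^sub>i\<close> span \<open>V\<close> (\<open>span_V_diagonal\<close>): the
  sum of these intersections with \<open>j - i\<close> fixed is invariant under \<open>A\<close> and \<open>A\<^sup>*\<close>, so irreducibility
  applies. Vanishing for the reversed orderings makes \<open>R\<^sup>d\<^sup>-\<^sup>2\<^sup>i\<close> injective from \<open>U\<^sub>i\<close> to \<open>U\<^sub>d\<^sub>-\<^sub>i\<close>, and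
  dually there is an injection back; hence \<open>R\<^sup>d\<^sup>-\<^sup>2\<^sup>i\<close> is bijective. From this every vector of
  \<open>U\<^sub>i\<^sub>+\<^sub>1\<close> lies in \<open>R U\<^sub>i\<close>, up to a vector of \<open>K\<^sub>i\<^sub>+\<^sub>1\<close> when \<open>2 (i + 1) \<le> d\<close> (\<open>V_split\<close>).
  The commutator of \<open>\<psi>\<close> and \<open>R\<close> now
  shows inductively that \<open>\<psi>\<close> maps \<open>U\<^sub>i\<^sub>+\<^sub>1\<close> into \<open>U\<^sub>i\<close> and \<open>U\<^sub>0\<close> to zero (\<open>psi_V_Suc\<close>, \<open>psi_V_0\<close>). So
  \<open>K \<psi> = q\<^sup>2 \<psi> K\<close>, and \<open>\<psi>\<close> is nilpotent, which makes \<open>C\<close> well defined.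

  The relations for \<open>C\<close> are calculations (\<open>C_psi\<close>, \<open>C_A\<close>, \<open>psi_Rd\<close>). For the identification with \<open>B\<close>,
  let \<open>W\<^sub>i\<close> be the eigenspace of \<open>C\<close> for \<open>q\<^sup>d\<^sup>-\<^sup>2\<^sup>i\<close>. With respect to the flag
  \<open>U\<^sub>0 + \<dots> + U\<^sub>i\<close> the operator \<open>C\<close> is triangular with the distinct diagonal entries \<open>q\<^sup>d\<^sup>-\<^sup>2\<^sup>i\<close>, so the
  \<open>W\<^sub>i\<close> span \<open>V\<close> (\<open>span_W\<close>) and \<open>W\<^sub>i\<close> lies in \<open>U\<^sub>0 + \<dots> + U\<^sub>i\<close>, hence in \<open>E\<^sub>0\<^sup>*V + \<dots> + E\<^sub>i\<^sup>*V\<close>. The relation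
  between \<open>A\<close> and \<open>C\<close> says that \<open>A - \<theta>\<^sub>d\<^sub>-\<^sub>i\<close> maps \<open>W\<^sub>i\<close> into \<open>W\<^sub>i\<^sub>+\<^sub>1\<close>, and downward induction on \<open>i\<close> places
  \<open>W\<^sub>i\<close> inside \<open>E\<^sub>0V + \<dots> + E\<^sub>d\<^sub>-\<^sub>iV\<close> (\<open>W_E\<close>). Therefore \<open>W\<^sub>i\<close> is contained in the summand
  \<open>U\<^sub>i\<^sup>\<Down>\<close> on which \<open>B\<close> acts as \<open>q\<^sup>d\<^sup>-\<^sup>2\<^sup>i\<close>, and \<open>B = C\<close> (\<open>weight_map_unique\<close>).
\<close>

section \<open>Modules from operators satisfying the defining relations\<close>

lemma poly_mapping_single_induct [case_names zero single add]:
  assumes "P 0"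
    and "\<And>k c. P (Poly_Mapping.single k c)"
    and "\<And>x y. P x \<Longrightarrow> P y \<Longrightarrow> P (x + y)"
  shows "P (x :: 'k \<Rightarrow>\<^sub>0 'c::comm_monoid_add)"
proof -
  have "x = (\<Sum>k\<in>Poly_Mapping.keys x. Poly_Mapping.single k (Poly_Mapping.lookup x k))"
    by (rule poly_mapping_eqI)
      (auto simp: lookup_sum lookup_single when_def sum.If_cases in_keys_iff sum.delta)
  moreover have "P (\<Sum>k\<in>S. Poly_Mapping.single k (Poly_Mapping.lookup x k))" if "finite S" for S
    using that by (induction S rule: finite_induct) (auto intro: assms)
  ultimately show ?thesis
    by (metis finite_keys)
qed

context td_space
begin

definition free_action :: "(uq_gen \<Rightarrow> 'b \<Rightarrow> 'b) \<Rightarrow> 'a uq_free \<Rightarrow> 'b \<Rightarrow> 'b" where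
  "free_action \<rho> x v =
     (\<Sum>w\<in>Poly_Mapping.keys x. scale (Poly_Mapping.lookup x w) (foldr \<rho> (letters w) v))"

lemma free_action_superset:
  fixes x :: "'a uq_free"
  assumes "finite S" "Poly_Mapping.keys x \<subseteq> S"
  shows "free_action \<rho> x v = (\<Sum>w\<in>S. scale (Poly_Mapping.lookup x w) (foldr \<rho> (letters w) v))"
  unfolding free_action_def using assms
  by (intro sum.mono_neutral_left) (auto simp: in_keys_iff)

lemma free_action_zero [simp]: "free_action \<rho> 0 v = 0"
  by (simp add: free_action_def)

lemma free_action_single [simp]:
  "free_action \<rho> (Poly_Mapping.single w c) v = scale c (foldr \<rho> (letters w) v)"
  by (simp add: free_action_def)

lemma free_action_add:
  fixes x y :: "'a uq_free"
  shows "free_action \<rho> (x + y) v = free_action \<rho> x v + free_action \<rho> y v"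
proof -
  let ?S = "Poly_Mapping.keys x \<union> Poly_Mapping.keys y"
  have "Poly_Mapping.keys (x + y) \<subseteq> ?S"
    by (rule Poly_Mapping.keys_add)
  then show ?thesis
    using free_action_superset[of ?S x \<rho> v] free_action_superset[of ?S y \<rho> v]
      free_action_superset[of ?S "x + y" \<rho> v]
    by (simp add: lookup_add scale_left_distrib sum.distrib)
qed

lemma free_action_uminus: "free_action \<rho> (- x) v = - free_action \<rho> x v"
  by (metis add.right_inverse free_action_add free_action_zero minus_unique)

lemma free_action_diff: "free_action \<rho> (x - y) v = free_action \<rho> x v - free_action \<rho> y v"
  by (metis diff_conv_add_uminus free_action_add free_action_uminus)

lemma free_action_one [simp]: "free_action \<rho> 1 v = v"
  using free_action_single[of \<rho> 0 1 v, unfolded single_one] by (simp add: zero_word_def)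

lemma linear_foldr:
  assumes "\<And>g. Vector_Spaces.linear scale scale (\<rho> g)"
  shows "Vector_Spaces.linear scale scale (foldr \<rho> gs)"
proof (induction gs)
  case Nil
  then show ?case using linear_id by (simp add: id_def)
next
  case (Cons g gs)
  interpret f: Vector_Spaces.linear scale scale "foldr \<rho> gs" by fact
  interpret g: Vector_Spaces.linear scale scale "\<rho> g" by (rule assms)
  show ?case
    by unfold_locales (simp_all add: f.add g.add f.scale g.scale)
qed

lemma linear_free_action:
  assumes "\<And>g. Vector_Spaces.linear scale scale (\<rho> g)"
  shows "Vector_Spaces.linear scale scale (free_action \<rho> x)"
proof -
  interpret f: Vector_Spaces.linear scale scale "foldr \<rho> gs" for gs
    using assms by (rule linear_foldr)
  show ?thesis
    by unfold_locales
      (simp_all add: free_action_def f.add f.scale scale_right_distrib sum.distrib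
        scale_sum_right mult.commute)
qed

lemma free_action_mult:
  fixes x y :: "'a uq_free"
  assumes "\<And>g. Vector_Spaces.linear scale scale (\<rho> g)"
  shows "free_action \<rho> (x * y) v = free_action \<rho> x (free_action \<rho> y v)"
proof -
  interpret l: Vector_Spaces.linear scale scale "free_action \<rho> z" for z
    using assms by (rule linear_free_action)
  interpret f: Vector_Spaces.linear scale scale "foldr \<rho> gs" for gs
    using assms by (rule linear_foldr)
  show ?thesis
  proof (induction x rule: poly_mapping_single_induct)
    case (single k c)
    show ?case
    proof (induction y rule: poly_mapping_single_induct)
      case (single l e)
      show ?case
        by (simp add: mult_single plus_word_def f.scale)
    qed (simp_all add: distrib_left free_action_add scale_right_distrib l.add f.add)
  qed (simp_all add: distrib_right free_action_add)
qed

end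

text \<open>
  The operators extend to an action of the free algebra, whose annihilator is a two-sided ideal;
  by assumption that ideal contains the defining relators, hence all of \<open>uq_ideal q\<close>.
\<close>

lemma (in td_space) uq_module_of_operators:
  assumes lin: "\<And>g. Vector_Spaces.linear scale scale (\<rho> g)"
    and rel: "\<And>x v. x \<in> uq_relators q \<Longrightarrow> free_action \<rho> x v = 0"
  shows "\<exists>act. uq_module q act \<and> (\<forall>g. act (uq_class q (free_gen g)) = \<rho> g)"
proof -
  let ?R = "ring_of_type_algebra :: 'a uq_free ring"
  interpret R: ring ?R
    by (rule ring_of_type_algebra_ring)
  have simps: "carrier ?R = UNIV" "x \<otimes>\<^bsub>?R\<^esub> y = x * y" "x \<oplus>\<^bsub>?R\<^esub> y = x + y"
    "\<one>\<^bsub>?R\<^esub> = 1" "\<zero>\<^bsub>?R\<^esub> = 0" for x y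
    by (simp_all add: ring_of_type_algebra_def)
  interpret l: Vector_Spaces.linear scale scale "free_action \<rho> x" for x
    using lin by (rule linear_free_action)
  define J where "J = {x. \<forall>v. free_action \<rho> x v = 0}"
  have inv: "\<ominus>\<^bsub>?R\<^esub> x = - x" for x
    by (rule R.minus_equality) (simp_all add: simps)
  have inv': "m_inv (add_monoid ?R) x = - x" for x
    using inv[of x] by (simp only: a_inv_def)
  have "ideal J ?R"
  proof (rule idealI)
    show "ring ?R" ..
    show "subgroup J (add_monoid ?R)"
    proof (rule subgroup.intro)
      show "inv\<^bsub>add_monoid ?R\<^esub> x \<in> J" if "x \<in> J" for x
        unfolding inv' using that by (simp add: J_def free_action_uminus)
    qed (simp_all add: J_def simps free_action_add)
  qed (auto simp: J_def simps free_action_mult[OF lin])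
  then have ideal_J: "uq_ideal q \<subseteq> J"
    unfolding uq_ideal_def using rel by (intro R.genideal_minimal) (auto simp: J_def)
  interpret I: ideal "uq_ideal q" ?R
    unfolding uq_ideal_def by (rule R.genideal_ideal) (simp add: simps)
  define act where "act C = free_action \<rho> (SOME x. x \<in> C)" for C
  have act_class: "act (uq_class q x) = free_action \<rho> x" for x
  proof -
    have "x \<in> uq_class q x"
      unfolding uq_class_def by (rule I.a_rcos_self) (simp add: simps)
    then have "(SOME y. y \<in> uq_class q x) \<in> uq_class q x"
      by (rule someI)
    then have "(SOME y. y \<in> uq_class q x) - x \<in> uq_ideal q"
      unfolding uq_class_def
      using I.a_rcos_module[of x] by (simp add: simps inv)
    then have "(SOME y. y \<in> uq_class q x) - x \<in> J"
      using ideal_J by blast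
    then show ?thesis
      unfolding act_def J_def by (auto simp: free_action_diff)
  qed
  have carrier: "\<exists>x. C = uq_class q x" if "C \<in> carrier (uq_sl2 q)" for C
    using that unfolding uq_sl2_def FactRing_def uq_class_def
    by (auto simp: A_RCOSETS_defs a_r_coset_def simps)
  have add: "uq_class q x \<oplus>\<^bsub>uq_sl2 q\<^esub> uq_class q y = uq_class q (x + y)" for x y
    unfolding uq_sl2_def FactRing_def uq_class_def
    using I.a_rcos_sum[of x y] by (simp add: simps)
  have mult: "uq_class q x \<otimes>\<^bsub>uq_sl2 q\<^esub> uq_class q y = uq_class q (x * y)" for x y
    unfolding uq_sl2_def FactRing_def uq_class_def
    using I.rcoset_mult_add[of x y] by (simp add: simps)
  have one: "\<one>\<^bsub>uq_sl2 q\<^esub> = uq_class q 1"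
    unfolding uq_sl2_def FactRing_def uq_class_def by (simp add: simps)
  have "uq_module q act"
    unfolding uq_module_def
  proof (intro conjI ballI allI)
    fix C assume "C \<in> carrier (uq_sl2 q)"
    then obtain x where "C = uq_class q x"
      using carrier by blast
    then show "Vector_Spaces.linear scale scale (act C)"
      by (simp add: act_class linear_free_action[OF lin])
  next
    fix C D v assume "C \<in> carrier (uq_sl2 q)" "D \<in> carrier (uq_sl2 q)"
    then obtain x y where "C = uq_class q x" "D = uq_class q y"
      using carrier by blast
    then show "act (C \<oplus>\<^bsub>uq_sl2 q\<^esub> D) v = act C v + act D v"
      "act (C \<otimes>\<^bsub>uq_sl2 q\<^esub> D) v = act C (act D v)"
      by (simp_all add: add mult act_class free_action_add free_action_mult[OF lin])
  qed (simp_all add: one act_class free_scalar_def zero_word_def)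
  moreover have "act (uq_class q (free_gen g)) = \<rho> g" for g
    by (simp add: act_class free_gen_def fun_eq_iff)
  ultimately show ?thesis by blast
qed

lemma (in td_space) uq_module_of_relations:
  assumes "Vector_Spaces.linear scale scale e" "Vector_Spaces.linear scale scale f"
    and "Vector_Spaces.linear scale scale k" "Vector_Spaces.linear scale scale k'"
    and kk': "\<And>v. k (k' v) = v" and k'k: "\<And>v. k' (k v) = v"
    and ke: "\<And>v. k (e v) = scale (q ^ 2) (e (k v))"
    and kf: "\<And>v. k (f v) = scale (inverse (q ^ 2)) (f (k v))"
    and ef: "\<And>v. e (f v) - f (e v) = scale (inverse (q - inverse q)) (k v - k' v)"
  shows "\<exists>act. uq_module q act \<and> act (uq_class q (free_gen Gen_e)) = e \<and>
    act (uq_class q (free_gen Gen_f)) = f \<and> act (uq_class q (free_gen Gen_k)) = k \<and>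
    act (uq_class q (free_gen Gen_kinv)) = k'"
proof -
  define \<rho> where "\<rho> g = (case g of Gen_e \<Rightarrow> e | Gen_f \<Rightarrow> f | Gen_k \<Rightarrow> k | Gen_kinv \<Rightarrow> k')" for g
  have lin: "Vector_Spaces.linear scale scale (\<rho> g)" for g
    using assms(1-4) by (cases g) (simp_all add: \<rho>_def)
  have \<rho>: "\<rho> Gen_e = e" "\<rho> Gen_f = f" "\<rho> Gen_k = k" "\<rho> Gen_kinv = k'"
    by (simp_all add: \<rho>_def)
  have gen: "free_action \<rho> (free_gen g) = \<rho> g" for g
    by (simp add: free_gen_def fun_eq_iff)
  have scalar: "free_action \<rho> (free_scalar c) v = scale c v" for c v
    by (simp add: free_scalar_def zero_word_def)
  have "free_action \<rho> x v = 0" if "x \<in> uq_relators q" for x v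
    using that unfolding uq_relators_def Let_def
    by (auto simp: free_action_diff free_action_mult[OF lin] gen scalar \<rho> kk' k'k ke kf ef)
  from uq_module_of_operators[OF lin this]
  obtain act where act: "uq_module q act" "\<And>g. act (uq_class q (free_gen g)) = \<rho> g"
    by blast
  then show ?thesis
    by (intro exI[of _ act]) (simp add: \<rho>)
qed

section \<open>Tridiagonal systems through their idempotents\<close>

text \<open>
  A tridiagonal system encoded by the resolutions of the identity \<open>E\<close> and \<open>Es\<close>. In this form
  membership in a sum of eigenspaces is the vanishing of the remaining components, so that
  intersections of such sums are conjunctions. The axioms are symmetric in the two operators and
  under reversing either ordering (\<open>swap\<close>, \<open>reverse\<close>), and each statement below is thereby
  available for all the orderings.
\<close>

locale tridiagonal_system = finite_dimensional_vector_space scale Basis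
  for scale :: "'a::field \<Rightarrow> 'b::ab_group_add \<Rightarrow> 'b" and Basis :: "'b set" +
  fixes d :: nat
    and A :: "'b \<Rightarrow> 'b" and E :: "nat \<Rightarrow> 'b \<Rightarrow> 'b" and th :: "nat \<Rightarrow> 'a"
    and As :: "'b \<Rightarrow> 'b" and Es :: "nat \<Rightarrow> 'b \<Rightarrow> 'b" and ths :: "nat \<Rightarrow> 'a"
  assumes linear_A: "Vector_Spaces.linear scale scale A"
    and linear_As: "Vector_Spaces.linear scale scale As"
    and linear_E: "i \<le> d \<Longrightarrow> Vector_Spaces.linear scale scale (E i)"
    and linear_Es: "i \<le> d \<Longrightarrow> Vector_Spaces.linear scale scale (Es i)"
    and sum_E: "(\<Sum>i\<le>d. E i x) = x"
    and sum_Es: "(\<Sum>i\<le>d. Es i x) = x"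
    and E_E: "i \<le> d \<Longrightarrow> j \<le> d \<Longrightarrow> i \<noteq> j \<Longrightarrow> E i (E j x) = 0"
    and Es_Es: "i \<le> d \<Longrightarrow> j \<le> d \<Longrightarrow> i \<noteq> j \<Longrightarrow> Es i (Es j x) = 0"
    and A_E: "i \<le> d \<Longrightarrow> A (E i x) = scale (th i) (E i x)"
    and As_Es: "i \<le> d \<Longrightarrow> As (Es i x) = scale (ths i) (Es i x)"
    and inj_th: "inj_on th {..d}"
    and inj_ths: "inj_on ths {..d}"
    and E_As_E: "i \<le> d \<Longrightarrow> j \<le> d \<Longrightarrow> i + 1 < j \<or> j + 1 < i \<Longrightarrow> E j (As (E i x)) = 0"
    and Es_A_Es: "i \<le> d \<Longrightarrow> j \<le> d \<Longrightarrow> i + 1 < j \<or> j + 1 < i \<Longrightarrow> Es j (A (Es i x)) = 0"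
    and E_nonzero: "i \<le> d \<Longrightarrow> \<exists>x. E i x \<noteq> 0"
    and Es_nonzero: "i \<le> d \<Longrightarrow> \<exists>x. Es i x \<noteq> 0"
    and irreducible: "subspace W \<Longrightarrow> A ` W \<subseteq> W \<Longrightarrow> As ` W \<subseteq> W \<Longrightarrow> W = {0} \<or> W = UNIV"
begin

lemma swap: "tridiagonal_system scale Basis d As Es ths A E th"
  by (rule tridiagonal_system.intro[OF finite_dimensional_vector_space_axioms
        tridiagonal_system_axioms.intro])
    (fact linear_A linear_As linear_E linear_Es sum_E sum_Es E_E Es_Es A_E As_Es inj_th inj_ths
      E_As_E Es_A_Es E_nonzero Es_nonzero | rule irreducible, assumption+)+

lemma sum_reverse: "(\<Sum>i\<le>d. f (d - i)) = (\<Sum>i\<le>d. f i)" for f :: "nat \<Rightarrow> 'b"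
  by (rule sum.reindex_bij_witness[of _ "\<lambda>i. d - i" "\<lambda>i. d - i"]) auto

lemma reverse: "tridiagonal_system scale Basis d A (\<lambda>i. E (d - i)) (\<lambda>i. th (d - i)) As Es ths"
proof (rule tridiagonal_system.intro[OF finite_dimensional_vector_space_axioms
      tridiagonal_system_axioms.intro])
  show "(\<Sum>i\<le>d. E (d - i) x) = x" for x
    using sum_reverse[of "\<lambda>i. E i x"] sum_E by simp
  show "inj_on (\<lambda>i. th (d - i)) {..d}"
    using inj_th by (intro inj_onI) (metis atMost_iff diff_diff_cancel diff_le_self inj_onD)
  show "i \<le> d \<Longrightarrow> j \<le> d \<Longrightarrow> i + 1 < j \<or> j + 1 < i \<Longrightarrow> E (d - j) (As (E (d - i) x)) = 0" for i j x
    by (rule E_As_E) auto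
  show "i \<le> d \<Longrightarrow> j \<le> d \<Longrightarrow> i \<noteq> j \<Longrightarrow> E (d - i) (E (d - j) x) = 0" for i j x
    by (rule E_E) auto
qed (fact linear_A linear_As linear_Es sum_Es Es_Es As_Es inj_ths Es_A_Es Es_nonzero
    | (rule linear_E A_E E_nonzero, rule diff_le_self) | rule irreducible, assumption+)+

lemma reverse_both_swap:
  "tridiagonal_system scale Basis d As (\<lambda>i. Es (d - i)) (\<lambda>i. ths (d - i))
     A (\<lambda>i. E (d - i)) (\<lambda>i. th (d - i))"
  by (rule tridiagonal_system.reverse[OF tridiagonal_system.swap[OF reverse]])

sublocale A: Vector_Spaces.linear scale scale A
  by (rule linear_A)

sublocale As: Vector_Spaces.linear scale scale As
  by (rule linear_As)

lemmas E_zero [simp] = module_hom.zero[OF module_hom_linearI[OF linear_E]]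
lemmas E_add = module_hom.add[OF module_hom_linearI[OF linear_E]]
lemmas E_diff = module_hom.diff[OF module_hom_linearI[OF linear_E]]
lemmas E_scale = module_hom.scale[OF module_hom_linearI[OF linear_E]]
lemmas E_sum = module_hom.sum[OF module_hom_linearI[OF linear_E]]
lemmas Es_zero [simp] = module_hom.zero[OF module_hom_linearI[OF linear_Es]]
lemmas Es_add = module_hom.add[OF module_hom_linearI[OF linear_Es]]
lemmas Es_diff = module_hom.diff[OF module_hom_linearI[OF linear_Es]]
lemmas Es_scale = module_hom.scale[OF module_hom_linearI[OF linear_Es]]

lemma E_idem:
  assumes "i \<le> d"
  shows "E i (E i x) = E i x"
proof -
  have "E i x = (\<Sum>j\<le>d. E i (E j x))"
    using assms by (metis E_sum sum_E)
  also have "\<dots> = (\<Sum>j\<in>{i}. E i (E j x))"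
    using assms by (intro sum.mono_neutral_right) (auto simp: E_E)
  finally show ?thesis by simp
qed

lemma E_A:
  assumes "i \<le> d"
  shows "E i (A x) = scale (th i) (E i x)"
proof -
  have "E i (A x) = E i (A (\<Sum>j\<le>d. E j x))"
    by (simp add: sum_E)
  also have "\<dots> = (\<Sum>j\<le>d. scale (th j) (E i (E j x)))"
    using assms by (simp add: A.sum A_E E_sum E_scale)
  also have "\<dots> = (\<Sum>j\<in>{i}. scale (th j) (E i (E j x)))"
    using assms by (intro sum.mono_neutral_right) (auto simp: E_E)
  finally show ?thesis
    using assms by (simp add: E_idem)
qed

lemma eq_zero_if_components:
  assumes "\<And>i. i \<le> d \<Longrightarrow> E i x = 0"
  shows "x = 0"
  using sum_E[of x] assms by simp

lemma E_As_eq_zero: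
  assumes "j \<le> d" "\<And>i. i \<le> d \<Longrightarrow> i \<le> j + 1 \<Longrightarrow> j \<le> i + 1 \<Longrightarrow> E i x = 0"
  shows "E j (As x) = 0"
proof -
  have "E j (As (E i x)) = 0" if "i \<le> d" for i
    using assms that E_As_E[of i j x] by (cases "i + 1 < j \<or> j + 1 < i") auto
  then have "(\<Sum>i\<le>d. E j (As (E i x))) = 0"
    by simp
  then show ?thesis
    using assms(1) by (simp add: E_sum[symmetric] As.sum[symmetric] sum_E)
qed

lemmas Es_As = tridiagonal_system.E_A[OF swap]
lemmas Es_A_eq_zero = tridiagonal_system.E_As_eq_zero[OF swap]
lemmas eq_zero_if_star_components = tridiagonal_system.eq_zero_if_components[OF swap]

lemma span_ranges_E:
  assumes "J \<subseteq> {..d}"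
  shows "span (\<Union>j\<in>J. range (E j)) = {x. \<forall>h\<le>d. h \<notin> J \<longrightarrow> E h x = 0}"
proof
  show "span (\<Union>j\<in>J. range (E j)) \<subseteq> {x. \<forall>h\<le>d. h \<notin> J \<longrightarrow> E h x = 0}"
  proof (rule span_minimal)
    show "subspace {x. \<forall>h\<le>d. h \<notin> J \<longrightarrow> E h x = 0}"
      by (auto simp: subspace_def E_add E_scale)
    show "(\<Union>j\<in>J. range (E j)) \<subseteq> {x. \<forall>h\<le>d. h \<notin> J \<longrightarrow> E h x = 0}"
      using assms by (auto intro!: E_E)
  qed
  show "{x. \<forall>h\<le>d. h \<notin> J \<longrightarrow> E h x = 0} \<subseteq> span (\<Union>j\<in>J. range (E j))"
  proof
    fix x assume "x \<in> {x. \<forall>h\<le>d. h \<notin> J \<longrightarrow> E h x = 0}"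
    then have "(\<Sum>h\<le>d. E h x) = (\<Sum>h\<in>J. E h x)"
      using assms by (intro sum.mono_neutral_right) auto
    moreover have "(\<Sum>h\<in>J. E h x) \<in> span (\<Union>j\<in>J. range (E j))"
      by (intro span_sum span_base) auto
    ultimately show "x \<in> span (\<Union>j\<in>J. range (E j))"
      by (simp add: sum_E)
  qed
qed

lemma span_ranges_Es:
  "J \<subseteq> {..d} \<Longrightarrow> span (\<Union>j\<in>J. range (Es j)) = {x. \<forall>h\<le>d. h \<notin> J \<longrightarrow> Es h x = 0}"
  by (rule tridiagonal_system.span_ranges_E[OF swap])

section \<open>The split decomposition\<close>

text \<open>
  \<open>V i j\<close> is \<open>(E\<^sub>0\<^sup>*V + \<dots> + E\<^sub>i\<^sup>*V) \<inter> (E\<^sub>jV + \<dots> + E\<^sub>dV)\<close>; thus \<open>V i i\<close> is the summand \<open>U\<^sub>i\<close> of the split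
  decomposition. No bound is put on \<open>i\<close> and \<open>j\<close>: for \<open>j > d\<close> the space is zero.
\<close>

definition V :: "nat \<Rightarrow> nat \<Rightarrow> 'b set" where
  "V i j = {x. (\<forall>h\<le>d. i < h \<longrightarrow> Es h x = 0) \<and> (\<forall>h\<le>d. h < j \<longrightarrow> E h x = 0)}"

lemma subspace_V: "subspace (V i j)"
  by (auto simp: subspace_def V_def E_add Es_add E_scale Es_scale)

lemma raise_V:
  assumes "x \<in> V i j"
  shows "A x - scale (th j) x \<in> V (Suc i) (Suc j)"
proof -
  have "Es h (A x) = 0" if "h \<le> d" "Suc i < h" for h
    using assms that by (intro Es_A_eq_zero) (auto simp: V_def)
  moreover have "E h (A x - scale (th j) x) = 0" if "h \<le> d" "h < Suc j" for h
    using assms that by (cases "h = j") (auto simp: V_def E_diff E_scale E_A)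
  ultimately show ?thesis
    using assms by (auto simp: V_def Es_diff Es_scale)
qed

lemma lower_V:
  assumes "x \<in> V (Suc i) (Suc j)"
  shows "As x - scale (ths (Suc i)) x \<in> V i j"
proof -
  have "E h (As x) = 0" if "h \<le> d" "h < j" for h
    using assms that by (intro E_As_eq_zero) (auto simp: V_def)
  moreover have "Es h (As x - scale (ths (Suc i)) x) = 0" if "h \<le> d" "i < h" for h
    using assms that by (cases "h = Suc i") (auto simp: V_def Es_diff Es_scale Es_As)
  ultimately show ?thesis
    using assms by (auto simp: V_def E_diff E_scale)
qed

lemma V_0_eigen:
  assumes "x \<in> V 0 j"
  shows "As x = scale (ths 0) x"
proof -
  have "As x - scale (ths 0) x = 0"
  proof (rule eq_zero_if_star_components)
    fix h assume "h \<le> d"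
    then show "Es h (As x - scale (ths 0) x) = 0"
      using assms by (cases "h = 0") (auto simp: V_def Es_diff Es_scale Es_As)
  qed
  then show ?thesis by simp
qed

lemma V_above_d:
  assumes "x \<in> V i j" "d < j"
  shows "x = 0"
  by (rule eq_zero_if_components) (use assms in \<open>auto simp: V_def\<close>)

lemma image_span_subset:
  assumes "Vector_Spaces.linear scale scale f" "\<And>x. x \<in> S \<Longrightarrow> f x \<in> span S"
  shows "f ` span S \<subseteq> span S"
proof -
  have "span (f ` S) \<subseteq> span S"
    using assms(2) by (intro span_minimal) auto
  then show ?thesis
    by (simp add: module_hom.span_image[OF module_hom_linearI[OF assms(1)]])
qed

text \<open>
  Along a diagonal \<open>j = i + r\<close>, the operator \<open>A\<close> maps \<open>V i j\<close> into \<open>V i j + V (i + 1) (j + 1)\<close> and \<open>A\<^sup>*\<close> maps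
  it into \<open>V i j + V (i - 1) (j - 1)\<close>. The sum over the diagonal is invariant under both, and
  irreducibility leaves two possibilities.
\<close>

lemma diagonal_sum_trivial:
  "span (\<Union>i. V i (i + r)) = {0} \<or> span (\<Union>i. V i (i + r)) = UNIV"
proof (rule irreducible)
  let ?X = "\<Union>i. V i (i + r)"
  have base: "x \<in> span ?X" if "x \<in> V i (i + r)" for x i
    using that by (blast intro: span_base)
  have "A x \<in> span ?X" if x: "x \<in> ?X" for x
  proof -
    obtain i where i: "x \<in> V i (i + r)"
      using x by blast
    have "(A x - scale (th (i + r)) x) + scale (th (i + r)) x \<in> span ?X"
      using raise_V[OF i] base[of _ "Suc i"] base[OF i] by (intro span_add span_scale) auto
    then show ?thesis by simp
  qed
  then show "A ` span ?X \<subseteq> span ?X"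
    by (rule image_span_subset[OF linear_A])
  have "As x \<in> span ?X" if x: "x \<in> ?X" for x
  proof -
    obtain i where i: "x \<in> V i (i + r)"
      using x by blast
    show ?thesis
    proof (cases i)
      case 0
      then show ?thesis
        using V_0_eigen i base[OF i] by (auto intro: span_scale)
    next
      case (Suc k)
      have "(As x - scale (ths i) x) + scale (ths i) x \<in> span ?X"
        using lower_V[of x k "k + r"] i Suc base[of _ k] base[OF i]
        by (intro span_add span_scale) auto
      then show ?thesis by simp
    qed
  qed
  then show "As ` span ?X \<subseteq> span ?X"
    by (rule image_span_subset[OF linear_As])
qed (rule subspace_span)

text \<open>For \<open>i < j\<close> the diagonal sum is annihilated by \<open>E 0\<close>, which excludes the whole space.\<close>

lemma V_eq_zero:
  assumes "x \<in> V i j" "i < j"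
  shows "x = 0"
proof -
  define r where "r = j - i"
  have "span (\<Union>i. V i (i + r)) \<noteq> UNIV"
  proof
    assume UNIV: "span (\<Union>i. V i (i + r)) = UNIV"
    have "span (\<Union>i. V i (i + r)) \<subseteq> {x. E 0 x = 0}"
      using assms(2)
      by (intro span_minimal) (auto simp: V_def r_def subspace_def E_add E_scale)
    then show False
      using UNIV E_nonzero[of 0] by auto
  qed
  then have "span (\<Union>i. V i (i + r)) = {0}"
    using diagonal_sum_trivial by blast
  moreover have "x \<in> V i (i + r)"
    using assms by (simp add: r_def)
  ultimately show ?thesis
    by (metis UN_iff UNIV_I singletonD span_base)
qed

text \<open>The main diagonal starts with \<open>V 0 0 = E\<^sub>0\<^sup>*V\<close>, which excludes the zero space.\<close>

lemma span_V_diagonal: "span (\<Union>i\<le>d. V i i) = UNIV"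
proof -
  obtain x where "Es 0 x \<noteq> 0"
    using Es_nonzero by blast
  moreover have "Es 0 x \<in> V 0 (0 + 0)"
    by (auto simp: V_def Es_Es)
  ultimately have "span (\<Union>i. V i (i + 0)) \<noteq> {0}"
    by (metis UN_iff UNIV_I singletonD span_base)
  then have "span (\<Union>i. V i (i + 0)) = UNIV"
    using diagonal_sum_trivial by blast
  moreover have "(\<Union>i. V i (i + 0)) \<subseteq> span (\<Union>i\<le>d. V i i)"
  proof
    fix x assume "x \<in> (\<Union>i. V i (i + 0))"
    then obtain i where i: "x \<in> V i i" by auto
    show "x \<in> span (\<Union>i\<le>d. V i i)"
    proof (cases "i \<le> d")
      case True
      then show ?thesis using i by (blast intro: span_base)
    next
      case False
      then show ?thesis using V_above_d[OF i] by (simp add: span_zero)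
    qed
  qed
  then have "span (\<Union>i. V i (i + 0)) \<subseteq> span (\<Union>i\<le>d. V i i)"
    by (rule span_minimal[OF _ subspace_span])
  ultimately show ?thesis
    by (simp only: top_unique)
qed

section \<open>Raising through the split decomposition\<close>

text \<open>
  \<open>raise_iter i n\<close> is \<open>(A - \<theta>\<^sub>i\<^sub>+\<^sub>n\<^sub>-\<^sub>1) \<cdots> (A - \<theta>\<^sub>i)\<close>; on \<open>U\<^sub>i\<close> it is the power \<open>R\<^sup>n\<close> of the raising map, but
  as a polynomial in \<open>A\<close> it has a kernel that can be read off from the eigenspaces of \<open>A\<close>.
\<close>

primrec raise_iter :: "nat \<Rightarrow> nat \<Rightarrow> 'b \<Rightarrow> 'b" where
  "raise_iter i 0 x = x"
| "raise_iter i (Suc n) x = A (raise_iter i n x) - scale (th (i + n)) (raise_iter i n x)"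

lemma raise_iter_V: "x \<in> V i j \<Longrightarrow> raise_iter j n x \<in> V (i + n) (j + n)"
proof (induction n)
  case (Suc n)
  then show ?case
    using raise_V[of "raise_iter j n x" "i + n" "j + n"] by simp
qed simp

lemma E_raise_iter:
  assumes "h \<le> d"
  shows "E h (raise_iter i n x) = scale (\<Prod>m<n. th h - th (i + m)) (E h x)"
proof (induction n)
  case (Suc n)
  have "E h (raise_iter i (Suc n) x) = scale (th h - th (i + n)) (E h (raise_iter i n x))"
    using assms by (simp add: E_diff E_scale E_A scale_left_diff_distrib)
  then show ?case
    by (simp add: Suc mult.commute)
qed simp

lemma raise_iter_shift:
  "raise_iter i (Suc n) x = raise_iter (Suc i) n (A x - scale (th i) x)"
proof (induction n)
  case (Suc n)
  then show ?case
    by (simp only: raise_iter.simps(2)[of i "Suc n"] raise_iter.simps(2)[of "Suc i" n] add_Suc_shift)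
qed simp

lemma linear_raise_iter: "Vector_Spaces.linear scale scale (raise_iter i n)"
proof (induction n)
  case 0
  have "raise_iter i 0 = (\<lambda>x. x)"
    by (simp add: fun_eq_iff)
  then show ?case
    by (simp add: linear_ident)
next
  case (Suc n)
  interpret l: Vector_Spaces.linear scale scale "raise_iter i n" by fact
  show ?case
    by unfold_locales (simp_all add: l.add l.scale A.add A.scale algebra_simps)
qed

lemma raise_iter_eq_zero:
  assumes "raise_iter i n x = 0" "h \<le> d" "h < i \<or> i + n \<le> h" "i + n \<le> Suc d"
  shows "E h x = 0"
proof -
  have "th h - th (i + m) \<noteq> 0" if "m < n" for m
    using inj_onD[OF inj_th, of h "i + m"] that assms by auto
  then have "(\<Prod>m<n. th h - th (i + m)) \<noteq> 0"
    by simp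
  then show ?thesis
    using E_raise_iter[of h i n x] assms by simp
qed

text \<open>This is \<open>V_eq_zero\<close> for the reversed ordering of the eigenspaces of \<open>A\<close>.\<close>

lemma V_down_eq_zero:
  assumes "\<And>h. h \<le> d \<Longrightarrow> i < h \<Longrightarrow> Es h x = 0" "\<And>h. h \<le> d \<Longrightarrow> d \<le> h + i \<Longrightarrow> E h x = 0"
  shows "x = 0"
proof -
  interpret r: tridiagonal_system scale Basis d A "\<lambda>i. E (d - i)" "\<lambda>i. th (d - i)" As Es ths
    by (rule reverse)
  have "x \<in> r.V i (Suc i)"
    using assms by (auto simp: r.V_def)
  then show ?thesis
    by (rule r.V_eq_zero) simp
qed

text \<open>
  The kernel of \<open>raise_iter i n\<close> is \<open>E\<^sub>iV + \<dots> + E\<^sub>i\<^sub>+\<^sub>n\<^sub>-\<^sub>1V\<close>. For \<open>2 i + n \<le> d\<close> this sum is contained in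
  \<open>E\<^sub>0V + \<dots> + E\<^sub>d\<^sub>-\<^sub>i\<^sub>-\<^sub>1V\<close>, which meets \<open>E\<^sub>0\<^sup>*V + \<dots> + E\<^sub>i\<^sup>*V\<close> trivially.
\<close>

lemma raise_iter_inj:
  assumes "x \<in> V i i" "2 * i + n \<le> d" "raise_iter i n x = 0"
  shows "x = 0"
proof (rule V_down_eq_zero[of i])
  show "h \<le> d \<Longrightarrow> i < h \<Longrightarrow> Es h x = 0" for h
    using assms(1) by (auto simp: V_def)
  show "h \<le> d \<Longrightarrow> d \<le> h + i \<Longrightarrow> E h x = 0" for h
    using assms(2) by (intro raise_iter_eq_zero[OF assms(3)]) auto
qed

lemma inj_on_raise_iter: "2 * i \<le> d \<Longrightarrow> inj_on (raise_iter i (d - 2 * i)) (V i i)"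
  using module_hom.inj_on_iff_eq_0[OF module_hom_linearI[OF linear_raise_iter] subspace_V, of i]
    raise_iter_inj[of _ i "d - 2 * i"] by auto

lemma raise_iter_image_subset:
  assumes "2 * i \<le> d"
  shows "raise_iter i (d - 2 * i) ` V i i \<subseteq> V (d - i) (d - i)"
proof -
  have "i + (d - 2 * i) = d - i"
    using assms by simp
  then show ?thesis
    using raise_iter_V[of _ i i "d - 2 * i"] by auto
qed

lemma dim_raise_iter_image:
  assumes "2 * i \<le> d"
  shows "dim (raise_iter i (d - 2 * i) ` V i i) = dim (V i i)"
proof -
  interpret p: finite_dimensional_vector_space_pair_1 scale Basis scale ..
  have "span (V i i) = V i i"
    by (simp add: subspace_V)
  then have "inj_on (raise_iter i (d - 2 * i)) (span (V i i))"
    using inj_on_raise_iter[OF assms] by (simp only:)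
  then show ?thesis
    by (rule p.dim_image_eq[OF linear_raise_iter])
qed

lemma dim_V_le:
  assumes "2 * i \<le> d"
  shows "dim (V i i) \<le> dim (V (d - i) (d - i))"
  using dim_subset[OF raise_iter_image_subset[OF assms]] dim_raise_iter_image[OF assms] by simp

text \<open>
  Exchanging \<open>A\<close> and \<open>A\<^sup>*\<close> and reversing both orderings turns \<open>U\<^sub>j\<close> into \<open>U\<^sub>d\<^sub>-\<^sub>j\<close>; the raising injection of
  the new system is a lowering injection of the given one.
\<close>

lemma dim_V_ge:
  assumes "2 * i \<le> d"
  shows "dim (V (d - i) (d - i)) \<le> dim (V i i)"
proof -
  interpret r: tridiagonal_system scale Basis d As "\<lambda>i. Es (d - i)" "\<lambda>i. ths (d - i)"
    A "\<lambda>i. E (d - i)" "\<lambda>i. th (d - i)"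
    by (rule reverse_both_swap)
  have "r.V j j = V (d - j) (d - j)" if "j \<le> d" for j
  proof -
    \<comment> \<open>The bounded quantifiers in the two descriptions correspond under \<open>h \<mapsto> d - h\<close>.\<close>
    have 1: "F k x = 0"
      if "\<forall>h\<le>d. j < h \<longrightarrow> F (d - h) x = 0" "k \<le> d" "k < d - j" for F :: "nat \<Rightarrow> 'b \<Rightarrow> 'b" and k x
      using that(1)[rule_format, of "d - k"] that(2,3) by simp
    have 2: "F (d - h) x = 0"
      if "\<forall>k\<le>d. k < d - j \<longrightarrow> F k x = 0" "h \<le> d" "j < h" for F :: "nat \<Rightarrow> 'b \<Rightarrow> 'b" and h x
      using that(1)[rule_format, of "d - h"] that(2,3) by simp
    have 3: "F k x = 0"
      if "\<forall>h\<le>d. h < j \<longrightarrow> F (d - h) x = 0" "k \<le> d" "d - j < k" for F :: "nat \<Rightarrow> 'b \<Rightarrow> 'b" and k x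
      using that(1)[rule_format, of "d - k"] that(2,3) \<open>j \<le> d\<close> by simp
    have 4: "F (d - h) x = 0"
      if "\<forall>k\<le>d. d - j < k \<longrightarrow> F k x = 0" "h \<le> d" "h < j" for F :: "nat \<Rightarrow> 'b \<Rightarrow> 'b" and h x
      using that(1)[rule_format, of "d - h"] that(2,3) \<open>j \<le> d\<close> by simp
    show ?thesis
      unfolding r.V_def V_def using 1[of E] 2[of E] 3[of Es] 4[of Es] by blast
  qed
  then show ?thesis
    using r.dim_V_le[OF assms] assms by simp
qed

lemma raise_iter_surj:
  assumes "2 * i \<le> d" "y \<in> V (d - i) (d - i)"
  obtains x where "x \<in> V i i" "raise_iter i (d - 2 * i) x = y"
proof -
  have "raise_iter i (d - 2 * i) ` V i i = V (d - i) (d - i)"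
    using dim_V_ge dim_raise_iter_image assms(1)
    by (intro subspace_dim_equal module_hom.subspace_image[OF module_hom_linearI[OF linear_raise_iter]]
        subspace_V raise_iter_image_subset) simp_all
  then have "y \<in> raise_iter i (d - 2 * i) ` V i i"
    using assms(2) by simp
  then show ?thesis
    using that by (elim imageE) simp
qed

text \<open>
  The alternatives for \<open>z\<close> say that \<open>z\<close> is zero or a vector of \<open>K\<^sub>i\<^sub>+\<^sub>1\<close>; in both cases \<open>\<psi>\<close> kills it.
  For \<open>2 (i + 1) \<le> d\<close>, applying \<open>R\<^sup>d\<^sup>-\<^sup>2\<^sup>i\<^sup>-\<^sup>1\<close> moves \<open>x\<close> into \<open>U\<^sub>d\<^sub>-\<^sub>i\<close>, where it is also reached by \<open>R\<^sup>d\<^sup>-\<^sup>2\<^sup>i y\<close> with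
  \<open>y\<close> in \<open>U\<^sub>i\<close>; the difference of \<open>x\<close> and \<open>R y\<close> is killed by \<open>R\<^sup>d\<^sup>-\<^sup>2\<^sup>i\<^sup>-\<^sup>1\<close>. In the upper half, \<open>x\<close> itself
  is a positive power of \<open>R\<close> applied to some vector.
\<close>

lemma V_split:
  assumes "x \<in> V (Suc i) (Suc i)" "i < d"
  obtains y z where "y \<in> V i i" "x = (A y - scale (th i) y) + z"
    and "z = 0 \<or> 2 * Suc i \<le> d \<and> z \<in> V (Suc i) (Suc i) \<and> (\<forall>h\<le>d. d - Suc i < h \<longrightarrow> E h z = 0)"
proof (cases "2 * Suc i \<le> d")
  case True
  define n where "n = d - 2 * Suc i + 1"
  have n: "Suc i + n = d - i" "Suc n = d - 2 * i" "2 * i \<le> d"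
    using True by (simp_all add: n_def)
  have "raise_iter (Suc i) n x \<in> V (d - i) (d - i)"
    using raise_iter_V[OF assms(1), of n] n by simp
  then obtain y where y: "y \<in> V i i" "raise_iter i (Suc n) y = raise_iter (Suc i) n x"
    using raise_iter_surj[of i "raise_iter (Suc i) n x"] n by auto
  define z where "z = x - (A y - scale (th i) y)"
  interpret l: Vector_Spaces.linear scale scale "raise_iter (Suc i) n"
    by (rule linear_raise_iter)
  have "raise_iter (Suc i) n z = 0"
    using y(2) by (simp only: raise_iter_shift z_def l.diff) simp
  then have zE: "E h z = 0" if "h \<le> d" "d - Suc i < h" for h
    using that n True by (intro raise_iter_eq_zero[of "Suc i" n]) (auto simp: n_def)
  have zV: "z \<in> V (Suc i) (Suc i)"
    unfolding z_def by (rule subspace_diff[OF subspace_V assms(1) raise_V[OF y(1)]])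
  have "x = (A y - scale (th i) y) + z"
    by (simp add: z_def)
  with y(1) show ?thesis
    by (rule that) (use True zE zV in simp)
next
  case False
  define k n where "k = d - Suc i" and "n = 2 * i + 1 - d"
  have kn: "2 * k \<le> d" "d - k = Suc i" "d - 2 * k = Suc n" "k + n = i"
    using False assms(2) by (simp_all add: k_def n_def)
  then obtain u where u: "u \<in> V k k" "raise_iter k (Suc n) u = x"
    using raise_iter_surj[of k x] assms by auto
  have "raise_iter k n u \<in> V i i"
    using raise_iter_V[OF u(1), of n] kn by simp
  then show ?thesis
    by (rule that[where z = 0]) (use u kn in auto)
qed

end

section \<open>The double lowering map\<close>

context finite_dimensional_vector_space
begin

lemma linear_inv_into:
  assumes "Vector_Spaces.linear scale scale f" "bij f"
  shows "Vector_Spaces.linear scale scale (inv_into UNIV f)"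
proof -
  interpret f: Vector_Spaces.linear scale scale f by fact
  have inj: "inj f" and surj: "surj f"
    using assms(2) by (simp_all add: bij_def)
  show ?thesis
    by unfold_locales
      (rule injD[OF inj], simp add: f.add f.scale surj_f_inv_f[OF surj])+
qed

lemma bij_if_weights:
  assumes lin: "Vector_Spaces.linear scale scale T"
    and span: "span (\<Union>i\<le>n. U i) = UNIV"
    and weight: "\<And>i u. i \<le> n \<Longrightarrow> u \<in> U i \<Longrightarrow> T u = scale (c i) u"
    and nz: "\<And>i. i \<le> n \<Longrightarrow> c i \<noteq> 0"
  shows "bij T"
proof -
  interpret T: Vector_Spaces.linear scale scale T by fact
  have "u \<in> range T" if "i \<le> n" "u \<in> U i" for i u
    using weight[OF that] nz[OF that(1)]
    by (intro range_eqI[of _ _ "scale (inverse (c i)) u"]) (simp add: T.scale)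
  then have "span (\<Union>i\<le>n. U i) \<subseteq> range T"
    by (intro span_minimal T.subspace_image subspace_UNIV) auto
  then have "surj T"
    using span by auto
  then show ?thesis
    using linear_surj_imp_inj[OF lin] by (simp add: bij_def)
qed

end

text \<open>
  The map \<open>K\<close> of the other split decomposition, with inverse \<open>Ki\<close>, and the map \<open>\<psi>\<close> characterised by
  its commutator with \<open>R = A - a K - a\<^sup>-\<^sup>1 K\<^sup>-\<^sup>1\<close> and its vanishing on the spaces \<open>K\<^sub>i\<close>.
\<close>

locale double_lowering = tridiagonal_system +
  fixes q a :: 'a and K Ki psi :: "'b \<Rightarrow> 'b"
  assumes q_nonzero: "q \<noteq> 0" and a_nonzero: "a \<noteq> 0"
    and th_eq: "i \<le> d \<Longrightarrow> th i = a * q powi (int d - 2 * int i) + inverse a * q powi (2 * int i - int d)"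
    and linear_K: "Vector_Spaces.linear scale scale K"
    and K_Ki [simp]: "K (Ki v) = v" and Ki_K [simp]: "Ki (K v) = v"
    and K_weight: "i \<le> d \<Longrightarrow> v \<in> V i i \<Longrightarrow> K v = scale (q powi (int d - 2 * int i)) v"
    and linear_psi: "Vector_Spaces.linear scale scale psi"
    and psi_R: "psi (A v - scale a (K v) - scale (inverse a) (Ki v))
        - (A (psi v) - scale a (K (psi v)) - scale (inverse a) (Ki (psi v)))
      = scale (q - inverse q) (K v - Ki v)"
    and psi_highest: "2 * i \<le> d \<Longrightarrow> v \<in> V i i \<Longrightarrow> (\<And>h. h \<le> d \<Longrightarrow> d - i < h \<Longrightarrow> E h v = 0) \<Longrightarrow> psi v = 0"
begin

definition wt :: "nat \<Rightarrow> 'a" where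
  "wt i = q powi (int d - 2 * int i)"

definition s :: 'a where
  "s = q - inverse q"

sublocale K: Vector_Spaces.linear scale scale K
  by (rule linear_K)

sublocale psi: Vector_Spaces.linear scale scale psi
  by (rule linear_psi)

lemma linear_Ki: "Vector_Spaces.linear scale scale Ki"
proof -
  have "inj K"
    by (metis Ki_K injI)
  then show ?thesis
    by unfold_locales (rule injD, assumption, simp add: K.add K.scale)+
qed

sublocale Ki: Vector_Spaces.linear scale scale Ki
  by (rule linear_Ki)

lemma wt_nonzero [simp]: "wt i \<noteq> 0"
  using q_nonzero by (simp add: wt_def)

lemma wt_Suc: "wt i = q ^ 2 * wt (Suc i)"
proof -
  have "q powi (int d - 2 * int i) = q powi (2 + (int d - 2 * int (Suc i)))"
    by (simp add: algebra_simps)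
  also have "\<dots> = q powi 2 * q powi (int d - 2 * int (Suc i))"
    by (rule power_int_add) (simp add: q_nonzero)
  finally show ?thesis
    by (simp add: wt_def)
qed

lemma wt_reverse:
  assumes "i \<le> d"
  shows "wt (d - i) = inverse (wt i)"
proof -
  have "wt (d - i) = q powi (- (int d - 2 * int i))"
    unfolding wt_def using assms by (intro arg_cong[where f = "\<lambda>n. q powi n"]) simp
  then show ?thesis
    by (simp only: wt_def power_int_minus)
qed

lemma th_wt:
  assumes "i \<le> d"
  shows "th i = a * wt i + inverse a * inverse (wt i)"
proof -
  have "2 * int i - int d = - (int d - 2 * int i)"
    by simp
  then have "q powi (2 * int i - int d) = inverse (wt i)"
    unfolding wt_def by (simp only: power_int_minus)
  then show ?thesis
    using th_eq[OF assms] by (simp add: wt_def)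
qed

text \<open>The eigenvalue \<open>th i\<close> is a function of \<open>wt i\<close>, so the weights inherit distinctness.\<close>

lemma wt_inj: "i \<le> d \<Longrightarrow> j \<le> d \<Longrightarrow> wt i = wt j \<longleftrightarrow> i = j"
  using inj_onD[OF inj_th, of i j] by (auto simp: th_wt)

lemma K_V: "i \<le> d \<Longrightarrow> v \<in> V i i \<Longrightarrow> K v = scale (wt i) v"
  by (simp add: K_weight wt_def)

lemma Ki_V:
  assumes "i \<le> d" "v \<in> V i i"
  shows "Ki v = scale (inverse (wt i)) v"
proof -
  have "Ki (K (scale (inverse (wt i)) v)) = Ki v"
    using assms by (simp add: K.scale K_V)
  then show ?thesis by simp
qed

lemma R_V:
  assumes "i \<le> d" "v \<in> V i i"
  shows "A v - scale a (K v) - scale (inverse a) (Ki v) = A v - scale (th i) v"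
  using assms by (simp add: K_V Ki_V th_wt scale_left_distrib)

lemma V_induct:
  assumes "subspace S" "\<And>i u. i \<le> d \<Longrightarrow> u \<in> V i i \<Longrightarrow> u \<in> S"
  shows "v \<in> S"
proof -
  have "span (\<Union>i\<le>d. V i i) \<subseteq> S"
    using assms by (intro span_minimal) auto
  then show ?thesis
    by (auto simp: span_V_diagonal)
qed

lemma linear_eq_if_eq_on_V:
  assumes "Vector_Spaces.linear scale scale f" "Vector_Spaces.linear scale scale g"
    and "\<And>i u. i \<le> d \<Longrightarrow> u \<in> V i i \<Longrightarrow> f u = g u"
  shows "f v = g v"
proof -
  interpret f: Vector_Spaces.linear scale scale f by fact
  interpret g: Vector_Spaces.linear scale scale g by fact
  have "v \<in> {v. f v = g v}"
    by (rule V_induct) (auto simp: subspace_def f.add f.scale g.add g.scale assms(3))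
  then show ?thesis by simp
qed

lemma psi_V_0: "v \<in> V 0 0 \<Longrightarrow> psi v = 0"
  by (rule psi_highest[of 0]) auto

text \<open>
  Modulo \<open>R U\<^sub>i\<close>, every vector of \<open>U\<^sub>i\<^sub>+\<^sub>1\<close> is killed by \<open>\<psi>\<close> (\<open>V_split\<close>), so the commutator
  relation propagates the lowering property from \<open>U\<^sub>i\<close> to \<open>U\<^sub>i\<^sub>+\<^sub>1\<close>.
\<close>

lemma psi_V_Suc: "Suc i \<le> d \<Longrightarrow> v \<in> V (Suc i) (Suc i) \<Longrightarrow> psi v \<in> V i i"
proof (induction i arbitrary: v rule: less_induct)
  case (less i)
  note i = less.prems(1) and v = less.prems(2)
  obtain y z where y: "y \<in> V i i" and v_eq: "v = (A y - scale (th i) y) + z"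
    and z: "z = 0 \<or> 2 * Suc i \<le> d \<and> z \<in> V (Suc i) (Suc i) \<and> (\<forall>h\<le>d. d - Suc i < h \<longrightarrow> E h z = 0)"
    using V_split[OF v] i by auto
  have id: "i \<le> d"
    using i by simp
  have "psi z = 0"
    using z psi_highest[of "Suc i" z] by auto
  then have "psi v = psi (A y - scale a (K y) - scale (inverse a) (Ki y))"
    by (simp add: v_eq psi.add R_V[OF id y])
  also have "\<dots> = (A (psi y) - scale a (K (psi y)) - scale (inverse a) (Ki (psi y)))
      + scale (q - inverse q) (K y - Ki y)"
    using psi_R[of y] by (simp add: algebra_simps)
  finally have psi_v: "psi v = \<dots>" .
  have "scale (q - inverse q) (K y - Ki y) \<in> V i i"
    using y id by (auto simp: K_V Ki_V intro!: subspace_V subspace_scale subspace_diff)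
  moreover have "A (psi y) - scale a (K (psi y)) - scale (inverse a) (Ki (psi y)) \<in> V i i"
  proof (cases i)
    case 0
    then show ?thesis
      using psi_V_0 y by (simp add: subspace_0 subspace_V)
  next
    case (Suc j)
    then have "psi y \<in> V j j"
      using less.IH[of j y] y i by simp
    then have "A (psi y) - scale (th j) (psi y) \<in> V (Suc j) (Suc j)"
      by (rule raise_V)
    moreover have R_y: "A (psi y) - scale a (K (psi y)) - scale (inverse a) (Ki (psi y))
        = A (psi y) - scale (th j) (psi y)"
      by (rule R_V) (use id Suc \<open>psi y \<in> V j j\<close> in auto)
    ultimately show ?thesis
      by (simp only: Suc)
  qed
  ultimately show "psi v \<in> V i i"
    unfolding psi_v by (intro subspace_add subspace_V)
qed


lemma K_psi: "K (psi v) = scale (q ^ 2) (psi (K v))"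
proof (rule linear_eq_if_eq_on_V[of "\<lambda>v. K (psi v)" "\<lambda>v. scale (q ^ 2) (psi (K v))"])
  show "Vector_Spaces.linear scale scale (\<lambda>v. K (psi v))"
    by unfold_locales (simp_all add: K.add K.scale psi.add psi.scale)
  show "Vector_Spaces.linear scale scale (\<lambda>v. scale (q ^ 2) (psi (K v)))"
    by unfold_locales (simp_all add: K.add K.scale psi.add psi.scale algebra_simps)
  fix i u assume u: "i \<le> d" "u \<in> V i i"
  show "K (psi u) = scale (q ^ 2) (psi (K u))"
  proof (cases i)
    case 0
    then show ?thesis
      using u K_V[OF u] by (simp add: psi_V_0 psi.scale)
  next
    case (Suc k)
    then have "psi u \<in> V k k"
      using u by (auto intro: psi_V_Suc)
    then have "K (psi u) = scale (wt k) (psi u)"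
      using Suc u by (intro K_V) auto
    then show ?thesis
      using Suc K_V[OF u] by (simp add: psi.scale wt_Suc[of k])
  qed
qed

lemma psi_Ki: "psi (Ki v) = scale (q ^ 2) (Ki (psi v))"
proof -
  have "K (psi (Ki v)) = K (scale (q ^ 2) (Ki (psi v)))"
    by (simp add: K_psi K.scale)
  then have "Ki (K (psi (Ki v))) = Ki (K (scale (q ^ 2) (Ki (psi v))))"
    by (rule arg_cong)
  then show ?thesis by (simp only: Ki_K)
qed

text \<open>
  Equivalent to \<open>K R = q\<^sup>-\<^sup>2 R K\<close>, but free of \<open>K\<^sup>-\<^sup>1\<close>.
\<close>

lemma K_A: "scale q (K (A v)) - scale (inverse q) (A (K v))
    = scale s (scale a (K (K v)) + scale (inverse a) v)"
proof (rule linear_eq_if_eq_on_V[of "\<lambda>v. scale q (K (A v)) - scale (inverse q) (A (K v))"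
      "\<lambda>v. scale s (scale a (K (K v)) + scale (inverse a) v)"])
  show "Vector_Spaces.linear scale scale (\<lambda>v. scale q (K (A v)) - scale (inverse q) (A (K v)))"
    by unfold_locales (simp_all add: K.add K.scale A.add A.scale algebra_simps)
  show "Vector_Spaces.linear scale scale
      (\<lambda>v. scale s (scale a (K (K v)) + scale (inverse a) v))"
    by unfold_locales (simp_all add: K.add K.scale algebra_simps)
  fix i u assume u: "i \<le> d" "u \<in> V i i"
  define w where "w = A u - scale (th i) u"
  have w: "w \<in> V (Suc i) (Suc i)"
    unfolding w_def by (rule raise_V) (rule u)
  have "K w = scale (wt (Suc i)) w"
  proof (cases "Suc i \<le> d")
    case True
    then show ?thesis using w by (rule K_V)
  next
    case False
    then have "w = 0"
      using V_above_d[OF w] by simp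
    then show ?thesis by simp
  qed
  then have qKw: "scale q (K w) = scale (inverse q * wt i) w"
    using q_nonzero by (simp add: wt_Suc[of i] power2_eq_square)
  have A_u: "A u = w + scale (th i) u"
    by (simp add: w_def)
  have "scale q (K (A u)) - scale (inverse q) (A (K u))
      = scale (q * th i * wt i - inverse q * wt i * th i) u"
    by (simp add: A_u K.add K.scale K_V[OF u] A.scale scale_right_distrib qKw
        scale_left_diff_distrib algebra_simps)
  also have "q * th i * wt i - inverse q * wt i * th i = s * (a * wt i * wt i + inverse a)"
    using wt_nonzero[of i] a_nonzero q_nonzero by (simp add: th_wt[OF u(1)] s_def field_simps)
  finally show "scale q (K (A u)) - scale (inverse q) (A (K u))
      = scale s (scale a (K (K u)) + scale (inverse a) u)"
    by (simp add: K_V[OF u] K.scale scale_left_distrib algebra_simps)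
qed

section \<open>The second weight operator in terms of the first\<close>

text \<open>
  The operator \<open>I - c \<psi>\<close>, unipotent because \<open>\<psi>\<close> is nilpotent; it enters with \<open>c = a q\<close> and
  \<open>c = a\<^sup>-\<^sup>1 q\<close>.
\<close>

definition unip :: "'a \<Rightarrow> 'b \<Rightarrow> 'b" where
  "unip c v = v - scale c (psi v)"

lemma linear_unip: "Vector_Spaces.linear scale scale (unip c)"
  by unfold_locales (simp_all add: unip_def psi.add psi.scale algebra_simps)

sublocale unip: Vector_Spaces.linear scale scale "unip c" for c
  by (rule linear_unip)

definition flag :: "nat \<Rightarrow> 'b set" where
  "flag i = span (\<Union>j\<le>i. V j j)"

lemma subspace_flag: "subspace (flag i)"
  by (simp add: flag_def)

lemma V_subset_flag: "j \<le> i \<Longrightarrow> V j j \<subseteq> flag i"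
  unfolding flag_def by (auto intro: span_base)

lemma flag_mono: "j \<le> i \<Longrightarrow> flag j \<subseteq> flag i"
  unfolding flag_def by (intro span_mono UN_mono) auto

lemma flag_0: "flag 0 = V 0 0"
  by (simp add: flag_def subspace_V)

lemma flag_d: "flag d = UNIV"
  by (simp add: flag_def span_V_diagonal)

lemma flag_star: "x \<in> flag i \<Longrightarrow> h \<le> d \<Longrightarrow> i < h \<Longrightarrow> Es h x = 0"
proof -
  assume "x \<in> flag i" "h \<le> d" "i < h"
  moreover have "flag i \<subseteq> {x. Es h x = 0}" if "h \<le> d" "i < h"
    unfolding flag_def using that
    by (intro span_minimal) (auto simp: V_def subspace_def Es_add Es_scale)
  ultimately show ?thesis by auto
qed

lemma psi_flag_Suc:
  assumes "Suc i \<le> d" "v \<in> flag (Suc i)"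
  shows "psi v \<in> flag i"
proof -
  have "psi u \<in> flag i" if "j \<le> Suc i" "u \<in> V j j" for j u
  proof (cases j)
    case 0
    then show ?thesis
      using that psi_V_0 by (simp add: subspace_0 subspace_flag)
  next
    case (Suc k)
    then have "psi u \<in> V k k"
      using that assms by (intro psi_V_Suc) auto
    then show ?thesis
      using V_subset_flag[of k i] that Suc by auto
  qed
  then have "flag (Suc i) \<subseteq> psi -` flag i"
    unfolding flag_def[of "Suc i"]
    by (intro span_minimal psi.subspace_vimage subspace_flag) auto
  then show ?thesis
    using assms by auto
qed

lemma psi_flag_0: "v \<in> flag 0 \<Longrightarrow> psi v = 0"
  by (simp add: flag_0 psi_V_0)

lemma mem_flag_descend:
  assumes "\<And>k. j \<le> k \<Longrightarrow> k < d \<Longrightarrow> x \<in> flag (Suc k) \<Longrightarrow> x \<in> flag k"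
    and "j \<le> d"
  shows "x \<in> flag j"
  using assms(2) by (induction rule: inc_induct) (simp_all add: flag_d assms(1))

text \<open>
  If \<open>v\<close> lies in a larger member of the flag, then \<open>v = (I - c \<psi>) v + c \<psi> v\<close> and the lowering property
  of \<open>\<psi>\<close> bring it down one step at a time.
\<close>

lemma flag_if_unip:
  assumes "unip c v \<in> flag j" "j \<le> d"
  shows "v \<in> flag j"
proof (rule mem_flag_descend)
  fix k assume k: "j \<le> k" "k < d" "v \<in> flag (Suc k)"
  have "psi v \<in> flag k"
    using k by (intro psi_flag_Suc) auto
  moreover have "unip c v \<in> flag k"
    using assms flag_mono[OF k(1)] by auto
  ultimately have "unip c v + scale c (psi v) \<in> flag k"
    by (intro subspace_add subspace_scale subspace_flag)
  then show "v \<in> flag k"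
    by (simp add: unip_def)
qed fact

lemma bij_unip: "bij (unip c)"
proof -
  have "v = 0" if "unip c v = 0" for v
  proof -
    have "v \<in> flag 0"
      by (rule flag_if_unip[of c]) (simp_all add: that subspace_0 subspace_flag)
    then show ?thesis
      using that by (simp add: unip_def psi_flag_0)
  qed
  then have "inj (unip c)"
    by (simp add: unip.inj_iff_eq_0)
  then show ?thesis
    using linear_inj_imp_surj[OF linear_unip] by (simp add: bij_def)
qed

definition dinv :: "'b \<Rightarrow> 'b" where
  "dinv = inv_into UNIV (unip (inverse a * q))"

lemma unip_dinv [simp]: "unip (inverse a * q) (dinv v) = v"
  unfolding dinv_def using bij_unip by (simp add: bij_def surj_f_inv_f)

lemma dinv_unip [simp]: "dinv (unip (inverse a * q) v) = v"
  unfolding dinv_def using bij_unip by (simp add: bij_def)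

lemma linear_dinv: "Vector_Spaces.linear scale scale dinv"
  unfolding dinv_def by (intro linear_inv_into linear_unip bij_unip)

sublocale dinv: Vector_Spaces.linear scale scale dinv
  by (rule linear_dinv)

text \<open>
  The candidate \<open>(I - a\<^sup>-\<^sup>1 q \<psi>)\<^sup>-\<^sup>1 (I - a q \<psi>) K\<close> for \<open>B\<close>. Identities for \<open>C\<close> are proved after multiplication by
  \<open>I - a\<^sup>-\<^sup>1 q \<psi>\<close>, where \<open>unip_C\<close> removes the inverse.
\<close>

definition C :: "'b \<Rightarrow> 'b" where
  "C v = dinv (unip (a * q) (K v))"

lemma unip_C: "unip (inverse a * q) (C v) = unip (a * q) (K v)"
  by (simp add: C_def)

lemma linear_C: "Vector_Spaces.linear scale scale C"
  by unfold_locales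
    (simp_all add: C_def K.add K.scale unip.add unip.scale dinv.add dinv.scale)

sublocale C: Vector_Spaces.linear scale scale C
  by (rule linear_C)

lemma unip_cancel: "unip (inverse a * q) x = unip (inverse a * q) y \<Longrightarrow> x = y"
  using dinv_unip by metis

lemma psi_unip: "psi (unip c v) = unip c (psi v)"
  by (simp add: unip_def psi.diff psi.scale)

lemma C_psi: "C (psi v) = scale (q ^ 2) (psi (C v))"
proof (rule unip_cancel)
  have "unip (inverse a * q) (psi (C v)) = psi (unip (a * q) (K v))"
    by (simp add: psi_unip[symmetric] unip_C)
  then show "unip (inverse a * q) (C (psi v)) = unip (inverse a * q) (scale (q ^ 2) (psi (C v)))"
    by (simp add: unip_C K_psi unip.scale psi_unip)
qed

text \<open>
  Writing \<open>A = R + a K + a\<^sup>-\<^sup>1 K\<^sup>-\<^sup>1\<close>, the commutator of \<open>\<psi>\<close> with each summand is known. The result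
  combines the two unipotent factors that make up \<open>C\<close>.
\<close>

lemma psi_A: "psi (A v) - A (psi v)
    = scale s (unip (a * q) (K v) - Ki (unip (inverse a * q) v))"
proof -
  define k l where "k = psi (K v)" and "l = Ki (psi v)"
  have K_psi': "K (psi v) = scale (q ^ 2) k" and psi_Ki': "psi (Ki v) = scale (q ^ 2) l"
    by (simp_all add: K_psi psi_Ki k_def l_def)
  have c: "s * (a * q) = a * q ^ 2 - a" "s * (inverse a * q) = inverse a * q ^ 2 - inverse a"
    using q_nonzero a_nonzero by (simp_all add: s_def field_simps power2_eq_square)
  have "psi (A v) - scale a k - scale (inverse a * q ^ 2) l
      - (A (psi v) - scale (a * q ^ 2) k - scale (inverse a) l) = scale s (K v - Ki v)"
    using psi_R[of v]
    by (simp add: psi.diff psi.scale K_psi' psi_Ki' k_def[symmetric] l_def[symmetric] s_def)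
  then have "psi (A v) - A (psi v) = scale s (K v - Ki v)
      - (scale (a * q ^ 2) k - scale a k) + (scale (inverse a * q ^ 2) l - scale (inverse a) l)"
    by (simp add: algebra_simps)
  also have "\<dots> = scale s (K v - Ki v) - scale (s * (a * q)) k + scale (s * (inverse a * q)) l"
    by (simp only: c scale_left_diff_distrib)
  also have "\<dots> = scale s (unip (a * q) (K v) - Ki (unip (inverse a * q) v))"
    by (simp add: unip_def Ki.diff Ki.scale k_def l_def scale_right_diff_distrib)
  finally show ?thesis .
qed

lemma Ki_unip_K: "Ki (unip c (K v)) = v - scale (c * inverse (q ^ 2)) (psi v)"
proof -
  have "psi (K v) = scale (inverse (q ^ 2)) (K (psi v))"
    using q_nonzero by (simp add: K_psi)
  then show ?thesis
    by (simp add: unip_def Ki.diff Ki.scale)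
qed

lemma unip_A: "unip c (A v) = A (unip c v) - scale (c * s) (unip (a * q) (K v) - Ki (unip (inverse a * q) v))"
proof -
  have "psi (A v) = A (psi v) + scale s (unip (a * q) (K v) - Ki (unip (inverse a * q) v))"
    using psi_A[of v] by (simp add: algebra_simps)
  then show ?thesis
    by (simp add: unip_def[of c] A.diff A.scale scale_right_distrib)
qed

text \<open>
  The counterpart of \<open>K_A\<close> for the parameter \<open>a\<^sup>-\<^sup>1\<close>. After multiplication by \<open>I - a\<^sup>-\<^sup>1 q \<psi>\<close>, both terms on
  the left are brought to a multiple of \<open>A (I - a q \<psi>) K\<close> plus a remainder by means of \<open>unip_A\<close>
  and \<open>K_A\<close>; the multiples cancel.
\<close>

lemma C_A: "scale q (C (A v)) - scale (inverse q) (A (C v))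
    = scale s (scale (inverse a) (C (C v)) + scale a v)"
proof (rule unip_cancel)
  let ?D = "unip (inverse a * q)" and ?N = "unip (a * q)"
  have c: "inverse q * (a * q * s) = s * a" "inverse q * (inverse a * q * s) = s * inverse a"
    using q_nonzero by simp_all
  have "scale q (?N (K (A v))) = ?N (scale q (K (A v)))"
    by (simp add: unip.scale)
  also have "scale q (K (A v)) = scale (inverse q) (A (K v)) + scale s (scale a (K (K v)) + scale (inverse a) v)"
    using K_A[of v] by (simp add: algebra_simps)
  also have "?N \<dots> = scale (inverse q) (?N (A (K v)))
      + scale (s * a) (?N (K (K v))) + scale (s * inverse a) (?N v)"
    by (simp add: unip.add unip.scale scale_right_distrib)
  also have "scale (inverse q) (?N (A (K v))) = scale (inverse q) (A (?N (K v)))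
      - scale (s * a) (?N (K (K v))) + scale (s * a) (Ki (?D (K v)))"
    by (simp only: unip_A[of "a * q" "K v"] scale_right_diff_distrib scale_scale c) simp
  finally have 1: "scale q (?N (K (A v))) = scale (inverse q) (A (?N (K v)))
      + scale (s * a) (Ki (?D (K v))) + scale (s * inverse a) (?N v)"
    by (simp add: algebra_simps)
  have 2: "scale (inverse q) (?D (A (C v))) = scale (inverse q) (A (?N (K v)))
      - scale (s * inverse a) (?N (K (C v))) + scale (s * inverse a) (Ki (?N (K v)))"
    by (simp only: unip_A[of "inverse a * q" "C v"] unip_C scale_right_diff_distrib scale_scale c) simp
  have 3: "scale (s * a) (Ki (?D (K v))) + scale (s * inverse a) (?N v)
      - scale (s * inverse a) (Ki (?N (K v))) = scale (s * a) (?D v)"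
  proof -
    have c: "s * a * (inverse a * q * inverse (q ^ 2)) = s * inverse q"
      "s * inverse a * (a * q) = s * q"
      "s * inverse a * (a * q * inverse (q ^ 2)) = s * inverse q"
      "s * a * (inverse a * q) = s * q"
      using q_nonzero a_nonzero by (simp_all add: power2_eq_square field_simps)
    show ?thesis
      by (simp only: Ki_unip_K) (simp only: unip_def scale_right_diff_distrib scale_scale c, simp)
  qed
  have "?D (scale q (C (A v)) - scale (inverse q) (A (C v)))
      = scale q (?N (K (A v))) - scale (inverse q) (?D (A (C v)))"
    by (simp add: unip.diff unip.scale unip_C)
  also have "\<dots> = scale (s * inverse a) (?N (K (C v))) + scale (s * a) (?D v)"
    unfolding 1 2 3[symmetric] by (simp add: algebra_simps)
  also have "\<dots> = ?D (scale s (scale (inverse a) (C (C v)) + scale a v))"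
    by (simp add: unip.add unip.scale unip_C scale_right_distrib)
  finally show "?D (scale q (C (A v)) - scale (inverse q) (A (C v)))
      = ?D (scale s (scale (inverse a) (C (C v)) + scale a v))" .
qed

text \<open>
  A formula for the inverse of \<open>C\<close> in disguise:
  \<open>K\<^sup>-\<^sup>1 (I - a\<^sup>-\<^sup>1 q \<psi>) = C\<^sup>-\<^sup>1 (I - a q \<psi>)\<close>.
\<close>

lemma C_Ki_unip: "C (Ki (unip (inverse a * q) v)) = unip (a * q) v"
proof (rule unip_cancel)
  show "unip (inverse a * q) (C (Ki (unip (inverse a * q) v)))
      = unip (inverse a * q) (unip (a * q) v)"
    by (simp add: unip_C) (simp add: unip_def psi.diff psi.scale algebra_simps)
qed

section \<open>Weight spaces of the second weight operator\<close>

lemma C_triangular: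
  assumes "u \<in> V i i" "i \<le> d"
  shows "unip (inverse a * q) (C u - scale (wt i) u) = scale (wt i * (inverse a * q - a * q)) (psi u)"
  using K_V[OF assms(2,1)]
  by (simp add: unip.diff unip_C unip.scale)
    (simp add: unip_def algebra_simps)

lemma C_flag_0:
  assumes "v \<in> flag 0"
  shows "C v = scale (wt 0) v"
proof -
  have "v \<in> V 0 0"
    using assms by (simp add: flag_0)
  then have "unip (inverse a * q) (C v - scale (wt 0) v) = unip (inverse a * q) 0"
    using C_triangular[of v 0] by (simp add: psi_V_0)
  then have "C v - scale (wt 0) v = 0"
    by (rule unip_cancel)
  then show ?thesis by simp
qed

lemma C_flag_Suc:
  assumes "Suc i \<le> d" "v \<in> flag (Suc i)"
  shows "C v - scale (wt (Suc i)) v \<in> flag i"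
proof -
  let ?T = "\<lambda>v. C v - scale (wt (Suc i)) v"
  interpret T: Vector_Spaces.linear scale scale ?T
    by unfold_locales (simp_all add: C.add C.scale algebra_simps)
  have "?T u \<in> flag i" if u: "j \<le> Suc i" "u \<in> V j j" for j u
  proof -
    have j: "j \<le> d"
      using u assms by simp
    have "psi u \<in> flag i"
      using psi_flag_Suc[OF assms(1)] V_subset_flag[of j "Suc i"] u by auto
    then have "unip (inverse a * q) (C u - scale (wt j) u) \<in> flag i"
      unfolding C_triangular[OF u(2) j] by (intro subspace_scale subspace_flag)
    then have 1: "C u - scale (wt j) u \<in> flag i"
      by (rule flag_if_unip) (use assms in simp)
    show ?thesis
    proof (cases "j = Suc i")
      case True
      then show ?thesis using 1 by simp
    next
      case False
      then have "u \<in> flag i"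
        using V_subset_flag[of j i] u by auto
      then have "(C u - scale (wt j) u) + scale (wt j - wt (Suc i)) u \<in> flag i"
        by (intro subspace_add subspace_scale subspace_flag 1)
      then show ?thesis
        by (simp add: scale_left_diff_distrib)
    qed
  qed
  then have "flag (Suc i) \<subseteq> ?T -` flag i"
    unfolding flag_def[of "Suc i"]
    by (intro span_minimal T.subspace_vimage subspace_flag) auto
  then show ?thesis
    using assms by auto
qed

text \<open>
  The eigenvalue \<open>\<mu>\<close> can be any scalar, so that the lemma applies in \<open>W_top\<close> to \<open>q\<^sup>-\<^sup>d\<^sup>-\<^sup>2\<close>. This value
  is \<open>wt 0\<close> if \<open>q\<^sup>2\<^sup>d\<^sup>+\<^sup>2 = 1\<close>, and otherwise it is not a weight at all.
\<close>

lemma eigenvector_in_flag: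
  assumes "C v = scale \<mu> v" "j \<le> d" "\<And>i. j < i \<Longrightarrow> i \<le> d \<Longrightarrow> \<mu> \<noteq> wt i"
  shows "v \<in> flag j"
proof (rule mem_flag_descend)
  fix k assume k: "j \<le> k" "k < d" "v \<in> flag (Suc k)"
  have "C v - scale (wt (Suc k)) v \<in> flag k"
    using k by (intro C_flag_Suc) auto
  then have "scale (\<mu> - wt (Suc k)) v \<in> flag k"
    by (simp add: assms(1) scale_left_diff_distrib)
  then have "scale (inverse (\<mu> - wt (Suc k))) (scale (\<mu> - wt (Suc k)) v) \<in> flag k"
    by (rule subspace_scale[OF subspace_flag])
  moreover have "\<mu> - wt (Suc k) \<noteq> 0"
    using assms(3)[of "Suc k"] k by simp
  ultimately show "v \<in> flag k"
    by simp
qed fact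

definition W :: "nat \<Rightarrow> 'b set" where
  "W i = {v. C v = scale (wt i) v}"

text \<open>
  On \<open>W 0 + \<dots> + W i\<close> the operator \<open>C - wt (i + 1)\<close> is onto by distinctness of the weights, so a
  vector of the next flag member can be corrected to an eigenvector.
\<close>

lemma span_W: "span (\<Union>i\<le>d. W i) = UNIV"
proof -
  have "flag i \<subseteq> span (\<Union>j\<le>i. W j)" if "i \<le> d" for i
    using that
  proof (induction i)
    case 0
    have "flag 0 \<subseteq> W 0"
      by (auto simp: W_def C_flag_0)
    then show ?case
      by (auto intro: span_base)
  next
    case (Suc i)
    let ?T = "\<lambda>v. C v - scale (wt (Suc i)) v"
    interpret T: Vector_Spaces.linear scale scale ?T
      by unfold_locales (simp_all add: C.add C.scale algebra_simps)
    let ?G = "span (\<Union>j\<le>i. W j)"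
    have "w \<in> ?T ` ?G" if "j \<le> i" "w \<in> W j" for j w
    proof (rule image_eqI)
      have "wt j - wt (Suc i) \<noteq> 0"
        using that Suc.prems wt_inj[of j "Suc i"] by auto
      moreover have "?T (scale c w) = scale (c * (wt j - wt (Suc i))) w" for c
        using that by (simp add: W_def C.scale right_diff_distrib scale_left_diff_distrib mult.commute)
      ultimately show "w = ?T (scale (inverse (wt j - wt (Suc i))) w)"
        by simp
      show "scale (inverse (wt j - wt (Suc i))) w \<in> ?G"
        using that by (intro span_scale span_base) auto
    qed
    then have onto: "?G \<subseteq> ?T ` ?G"
      by (intro span_minimal T.subspace_image subspace_span) auto
    show ?case
    proof
      fix x assume "x \<in> flag (Suc i)"
      then have "?T x \<in> ?G"
        using C_flag_Suc Suc by auto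
      then obtain g where g: "g \<in> ?G" "?T x = ?T g"
        using onto by blast
      have "?T (x - g) = 0"
        using g(2) by (simp only: T.diff) simp
      then have "x - g \<in> W (Suc i)"
        by (simp add: W_def)
      then have "x - g \<in> span (\<Union>j\<le>Suc i. W j)"
        by (intro span_base) auto
      moreover have "g \<in> span (\<Union>j\<le>Suc i. W j)"
        using g(1) span_mono[of "\<Union>j\<le>i. W j" "\<Union>j\<le>Suc i. W j"] by fastforce
      ultimately have "(x - g) + g \<in> span (\<Union>j\<le>Suc i. W j)"
        by (rule span_add)
      then show "x \<in> span (\<Union>j\<le>Suc i. W j)" by simp
    qed
  qed
  from this[of d] show ?thesis
    by (auto simp: flag_d)
qed

text \<open>
  \<open>A - \<theta>\<^sub>d\<^sub>-\<^sub>i\<close> multiplies the eigenvalue of \<open>C\<close> by \<open>q\<^sup>-\<^sup>2\<close>, which is \<open>C_A\<close> evaluated on \<open>W i\<close>. For \<open>i < d\<close> the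
  result lies in \<open>W (i + 1)\<close>.
\<close>

lemma C_raise_W:
  assumes "i \<le> d" "v \<in> W i"
  shows "C (A v - scale (th (d - i)) v) = scale (inverse (q ^ 2) * wt i) (A v - scale (th (d - i)) v)"
proof -
  have Cv: "C v = scale (wt i) v"
    using assms by (simp add: W_def)
  have th: "th (d - i) = a * inverse (wt i) + inverse a * wt i"
    using th_wt[of "d - i"] wt_reverse[OF assms(1)] by simp
  have "scale q (C (A v)) = scale (inverse q * wt i) (A v) + scale (s * (inverse a * wt i * wt i + a)) v"
    using C_A[of v] by (simp add: Cv C.scale A.scale scale_left_distrib algebra_simps)
  also have "s * (inverse a * wt i * wt i + a) = q * th (d - i) * wt i - inverse q * wt i * th (d - i)"
    using wt_nonzero[of i] a_nonzero q_nonzero by (simp add: th s_def field_simps)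
  finally have "scale (inverse q) (scale q (C (A v)))
      = scale (inverse q) (scale (inverse q * wt i) (A v)
        + scale (q * th (d - i) * wt i - inverse q * wt i * th (d - i)) v)"
    by simp
  then have "C (A v) = scale (inverse (q ^ 2) * wt i) (A v)
      + scale (th (d - i) * wt i - inverse (q ^ 2) * wt i * th (d - i)) v"
    using q_nonzero
    by (simp add: scale_right_distrib right_diff_distrib power2_eq_square mult.assoc)
  then show ?thesis
    by (simp add: C.diff C.scale Cv scale_left_diff_distrib scale_right_diff_distrib algebra_simps)
qed

text \<open>
  The vector \<open>w = (A - \<theta>\<^sub>0) v\<close> satisfies \<open>C w = q\<^sup>-\<^sup>d\<^sup>-\<^sup>2 w\<close> with a scalar different from every
  weight except possibly \<open>wt 0\<close>. So \<open>w\<close> lies in \<open>U\<^sub>0 = E\<^sub>0\<^sup>*V\<close>. Its component in \<open>E\<^sub>0V\<close> vanishes, and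
  \<open>E\<^sub>0\<^sup>*V\<close> meets \<open>E\<^sub>1V + \<dots> + E\<^sub>dV\<close> trivially.
\<close>

lemma W_top:
  assumes "v \<in> W d"
  shows "A v = scale (th 0) v"
proof -
  define w where "w = A v - scale (th 0) v"
  have "C w = scale (inverse (q ^ 2) * wt d) w"
    unfolding w_def using C_raise_W[of d v] assms by simp
  moreover have "inverse (q ^ 2) * wt d \<noteq> wt i" if i: "0 < i" "i \<le> d" for i
  proof
    assume eq: "inverse (q ^ 2) * wt d = wt i"
    obtain k where k: "i = Suc k"
      using i by (cases i) auto
    have "wt d = wt k"
      using eq wt_Suc[of k] q_nonzero k by (simp add: field_simps)
    then show False
      using wt_inj[of d k] i k by simp
  qed
  ultimately have "w \<in> V 0 0"
    using eigenvector_in_flag[of w _ 0] flag_0 by auto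
  moreover have "E 0 w = 0"
    by (simp add: w_def E_diff E_scale E_A)
  ultimately have "w \<in> V 0 1"
    by (simp add: V_def)
  then have "w = 0"
    by (rule V_eq_zero) simp
  then show ?thesis
    by (simp add: w_def)
qed

text \<open>
  Downward induction: if \<open>(A - \<theta>\<^sub>d\<^sub>-\<^sub>i) v\<close> has no components beyond \<open>d - i - 1\<close>, then \<open>v\<close> has none
  beyond \<open>d - i\<close>.
\<close>

lemma W_E:
  assumes "i \<le> d"
  shows "v \<in> W i \<Longrightarrow> h \<le> d \<Longrightarrow> d - i < h \<Longrightarrow> E h v = 0"
  using assms
proof (induction i arbitrary: v h rule: inc_induct)
  case base
  then have "scale (th h) (E h v) = scale (th 0) (E h v)"
    using W_top[of v] E_A[of h v] E_scale[of h] by metis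
  moreover have "th h \<noteq> th 0"
    using inj_onD[OF inj_th, of h 0] base by auto
  ultimately show ?case
    by auto
next
  case (step k)
  define w where "w = A v - scale (th (d - k)) v"
  have "w \<in> W (Suc k)"
    using C_raise_W[of k v] step.hyps step.prems wt_Suc[of k] q_nonzero
    by (simp add: W_def w_def[symmetric])
  then have "E h w = 0"
    using step.IH[of w h] step.prems by simp
  then have "scale (th h - th (d - k)) (E h v) = 0"
    using step.prems by (simp add: w_def E_diff E_scale E_A scale_left_diff_distrib)
  moreover have "th h \<noteq> th (d - k)"
    using inj_onD[OF inj_th, of h "d - k"] step.prems by auto
  ultimately show ?case
    by simp
qed

lemma W_Es:
  assumes "v \<in> W i" "i \<le> d" "h \<le> d" "i < h"
  shows "Es h v = 0"
proof (rule flag_star[OF _ assms(3,4)])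
  show "v \<in> flag i"
    using assms wt_inj by (intro eigenvector_in_flag[of _ "wt i"]) (auto simp: W_def)
qed

section \<open>The defining relations\<close>

text \<open>
  The second hypothesis says that \<open>B\<close> acts on \<open>U\<^sub>i\<^sup>\<Down>\<close> as \<open>q\<^sup>d\<^sup>-\<^sup>2\<^sup>i\<close>. Since \<open>W i\<close> is contained in \<open>U\<^sub>i\<^sup>\<Down>\<close> and the
  \<open>W i\<close> span \<open>V\<close>, this determines \<open>B\<close>.
\<close>

lemma weight_map_unique:
  assumes "Vector_Spaces.linear scale scale B"
    and "\<And>i v. i \<le> d \<Longrightarrow> (\<And>h. h \<le> d \<Longrightarrow> i < h \<Longrightarrow> Es h v = 0) \<Longrightarrow>
      (\<And>h. h \<le> d \<Longrightarrow> d - i < h \<Longrightarrow> E h v = 0) \<Longrightarrow> B v = scale (q powi (int d - 2 * int i)) v"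
  shows "B = C"
proof
  fix v
  interpret B: Vector_Spaces.linear scale scale B by fact
  have "B w = C w" if "i \<le> d" "w \<in> W i" for i w
    using assms(2)[OF that(1)] W_E[OF that] W_Es[OF that(2,1)] that(2) by (simp add: W_def wt_def)
  then have "span (\<Union>i\<le>d. W i) \<subseteq> {v. B v = C v}"
    by (intro span_minimal) (auto simp: subspace_def B.add B.scale C.add C.scale)
  then show "B v = C v"
    by (auto simp: span_W)
qed

lemma bij_C: "bij C"
  by (rule bij_if_weights[OF linear_C span_W, of wt]) (simp_all add: W_def)

definition Ci :: "'b \<Rightarrow> 'b" where
  "Ci = inv_into UNIV C"

lemma C_Ci [simp]: "C (Ci v) = v"
  unfolding Ci_def using bij_C by (simp add: bij_def surj_f_inv_f)

lemma Ci_C [simp]: "Ci (C v) = v"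
  unfolding Ci_def using bij_C by (simp add: bij_def)

lemma linear_Ci: "Vector_Spaces.linear scale scale Ci"
  unfolding Ci_def by (intro linear_inv_into linear_C bij_C)

sublocale Ci: Vector_Spaces.linear scale scale Ci
  by (rule linear_Ci)

definition Rd :: "'b \<Rightarrow> 'b" where
  "Rd v = A v - scale (inverse a) (C v) - scale a (Ci v)"

lemma linear_Rd: "Vector_Spaces.linear scale scale Rd"
  by unfold_locales
    (simp_all add: Rd_def A.add A.scale C.add C.scale Ci.add Ci.scale algebra_simps)

lemma C_Rd: "C (Rd v) = scale (inverse (q ^ 2)) (Rd (C v))"
proof -
  have "scale q (C (A v)) = scale (inverse q) (A (C v)) + scale s (scale (inverse a) (C (C v)) + scale a v)"
    using C_A[of v] by (simp add: algebra_simps)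
  then have "scale q (C (Rd v)) = scale (inverse q) (Rd (C v))"
    by (simp add: Rd_def C.diff C.add C.scale s_def scale_right_diff_distrib scale_right_distrib
        scale_left_diff_distrib algebra_simps)
  then have "scale (inverse q) (scale q (C (Rd v))) = scale (inverse q) (scale (inverse q) (Rd (C v)))"
    by simp
  then show ?thesis
    using q_nonzero by (simp add: power2_eq_square)
qed

lemma psi_Ci: "psi (Ci v) = scale (q ^ 2) (Ci (psi v))"
proof -
  have "C (psi (Ci v)) = C (scale (q ^ 2) (Ci (psi v)))"
    by (simp add: C_psi C.scale)
  then have "Ci (C (psi (Ci v))) = Ci (C (scale (q ^ 2) (Ci (psi v))))"
    by (rule arg_cong)
  then show ?thesis by (simp only: Ci_C)
qed

text \<open>
  By \<open>psi_A\<close> the commutator of \<open>\<psi>\<close> and \<open>A\<close> is the same combination of \<open>(I - a q \<psi>) K\<close> and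
  \<open>K\<^sup>-\<^sup>1 (I - a\<^sup>-\<^sup>1 q \<psi>)\<close>; \<open>unip_C\<close> and \<open>C_Ki_unip\<close> rewrite both in terms of \<open>C\<close>.
\<close>

lemma psi_Rd: "psi (Rd v) - Rd (psi v) = scale s (C v - Ci v)"
proof -
  define k l where "k = psi (C v)" and "l = Ci (psi v)"
  have C_psi': "C (psi v) = scale (q ^ 2) k" and psi_Ci': "psi (Ci v) = scale (q ^ 2) l"
    by (simp_all add: C_psi psi_Ci k_def l_def)
  have c: "s * (a * q) = a * q ^ 2 - a" "s * (inverse a * q) = inverse a * q ^ 2 - inverse a"
    using q_nonzero a_nonzero by (simp_all add: s_def field_simps power2_eq_square)
  have "Ki (unip (inverse a * q) v) = Ci (unip (a * q) v)"
    using C_Ki_unip[of v] Ci_C by metis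
  then have "psi (A v) - A (psi v) = scale s (unip (inverse a * q) (C v) - Ci (unip (a * q) v))"
    using psi_A[of v] by (simp add: unip_C)
  also have "\<dots> = scale s (C v - Ci v) - scale (s * (inverse a * q)) k + scale (s * (a * q)) l"
    by (simp add: unip_def Ci.diff Ci.scale k_def l_def scale_right_diff_distrib)
  finally have "psi (A v) - A (psi v) = scale s (C v - Ci v)
      - scale (inverse a * q ^ 2 - inverse a) k + scale (a * q ^ 2 - a) l"
    by (simp only: c)
  then show ?thesis
    by (simp add: Rd_def psi.diff psi.add psi.scale C_psi' psi_Ci' k_def[symmetric] l_def[symmetric]
        scale_left_diff_distrib algebra_simps)
qed

end

section \<open>From tridiagonal pairs to the idempotent axioms\<close>

context td_space
begin

lemma eigenspace_inject:
  assumes "eigenspace A \<theta> = eigenspace A \<theta>'" "eigenspace A \<theta> \<noteq> {0}" "A 0 = 0"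
  shows "\<theta> = \<theta>'"
proof -
  have "0 \<in> eigenspace A \<theta>"
    using assms(3) by (simp add: eigenspace_def)
  then obtain v where v: "v \<in> eigenspace A \<theta>" "v \<noteq> 0"
    using assms(2) by blast
  then have "v \<in> eigenspace A \<theta>'"
    using assms(1) by simp
  then have "A v = scale \<theta>' v"
    by (simp add: eigenspace_def)
  moreover have "A v = scale \<theta> v"
    using v(1) by (simp add: eigenspace_def)
  ultimately show ?thesis
    using v(2) by auto
qed

text \<open>
  An eigenbasis spans \<open>V\<close>, so each identity for the primitive idempotents only has to be checked on
  the eigenspaces, where the \<open>E i\<close> act as zero or the identity.
\<close>

lemma standard_idempotents_facts:
  assumes A: "Vector_Spaces.linear scale scale A" and As: "Vector_Spaces.linear scale scale As"
    and diag: "diagonalizable A" and E: "standard_idempotents A As d E"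
  defines "th \<equiv> \<lambda>i. idempotent_eigenvalue A (E i)"
  shows "\<And>i. i \<le> d \<Longrightarrow> Vector_Spaces.linear scale scale (E i)"
    and "\<And>x. (\<Sum>i\<le>d. E i x) = x"
    and "\<And>i j x. i \<le> d \<Longrightarrow> j \<le> d \<Longrightarrow> i \<noteq> j \<Longrightarrow> E i (E j x) = 0"
    and "\<And>i x. i \<le> d \<Longrightarrow> A (E i x) = scale (th i) (E i x)"
    and "inj_on th {..d}"
    and "\<And>i j x. i \<le> d \<Longrightarrow> j \<le> d \<Longrightarrow> i + 1 < j \<or> j + 1 < i \<Longrightarrow> E j (As (E i x)) = 0"
    and "\<And>i. i \<le> d \<Longrightarrow> \<exists>x. E i x \<noteq> 0"
proof -
  interpret A: Vector_Spaces.linear scale scale A by fact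
  obtain W where ord: "standard_ordering A As d W"
    and prim: "\<And>i. i \<le> d \<Longrightarrow> primitive_idempotent A (W i) (E i)"
    using E unfolding standard_idempotents_def by auto
  show lin: "Vector_Spaces.linear scale scale (E i)" if "i \<le> d" for i
    using prim[OF that] by (simp add: primitive_idempotent_def)
  have bij: "bij_betw W {0..d} (eigenspaces A)"
    using ord by (simp add: standard_ordering_def)
  have "\<exists>\<theta>. W i = eigenspace A \<theta> \<and> eigenspace A \<theta> \<noteq> {0}" if "i \<le> d" for i
    using prim[OF that] unfolding primitive_idempotent_def eigenspaces_def by auto
  then obtain t where t: "\<And>i. i \<le> d \<Longrightarrow> W i = eigenspace A (t i) \<and> eigenspace A (t i) \<noteq> {0}"
    by metis
  have subspace_W: "subspace (W i)" if "i \<le> d" for i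
    using t[OF that]
    by (auto simp: eigenspace_def subspace_def A.add A.scale scale_right_distrib mult.commute)
  have W_inj: "W i = W j \<longleftrightarrow> i = j" if "i \<le> d" "j \<le> d" for i j
    using bij that by (auto simp: bij_betw_def dest: inj_onD)
  have E_W: "E i v = v" if "i \<le> d" "v \<in> W i" for i v
    using prim[OF that(1)] that(2) by (simp add: primitive_idempotent_def)
  have E_W': "E i v = 0" if "i \<le> d" "j \<le> d" "i \<noteq> j" "v \<in> W j" for i j v
  proof -
    have "W j \<in> eigenspaces A - {W i}"
      using prim[OF that(2)] W_inj that by (auto simp: primitive_idempotent_def)
    then show ?thesis
      using prim[OF that(1)] that(4) by (auto simp: primitive_idempotent_def)
  qed
  obtain S where S: "independent S" "span S = UNIV" "\<And>v. v \<in> S \<Longrightarrow> \<exists>\<theta>. A v = scale \<theta> v"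
    using diag by (auto simp: diagonalizable_def)
  have "v \<in> (\<Union>i\<le>d. W i)" if v: "v \<in> S" for v
  proof -
    obtain \<theta> where \<theta>: "A v = scale \<theta> v"
      using S(3) v by blast
    have "v \<noteq> 0"
      using S(1) v dependent_zero by blast
    then have "eigenspace A \<theta> \<in> eigenspaces A"
      using \<theta> by (auto simp: eigenspaces_def eigenspace_def)
    then have "eigenspace A \<theta> \<in> W ` {0..d}"
      using bij by (simp add: bij_betw_def)
    then obtain i where "i \<le> d" "eigenspace A \<theta> = W i"
      by auto
    moreover have "v \<in> eigenspace A \<theta>"
      using \<theta> by (simp add: eigenspace_def)
    ultimately show ?thesis
      by auto
  qed
  then have S_W: "S \<subseteq> (\<Union>i\<le>d. W i)"
    by blast
  have induct: "x \<in> T" if "subspace T" "\<And>i v. i \<le> d \<Longrightarrow> v \<in> W i \<Longrightarrow> v \<in> T" for T x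
  proof -
    have "span S \<subseteq> T"
      using S_W that by (intro span_minimal) auto
    then show ?thesis
      using S(2) by auto
  qed
  note add = module_hom.add[OF module_hom_linearI[OF lin]]
    and scale = module_hom.scale[OF module_hom_linearI[OF lin]]
    and zero = module_hom.zero[OF module_hom_linearI[OF lin]]
  have E_in_W: "E i x \<in> W i" if "i \<le> d" for i x
  proof -
    have "x \<in> {x. E i x \<in> W i}"
    proof (rule induct)
      show "subspace {x. E i x \<in> W i}"
        using subspace_W[OF that] that by (auto simp: subspace_def add scale zero)
      fix j v assume "j \<le> d" "v \<in> W j"
      then show "v \<in> {x. E i x \<in> W i}"
        using that E_W E_W'[of i j v] subspace_W[OF that] by (cases "i = j") (auto simp: subspace_0)
    qed
    then show ?thesis by simp
  qed
  show "(\<Sum>i\<le>d. E i x) = x" for x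
  proof -
    have "x \<in> {x. (\<Sum>i\<le>d. E i x) = x}"
    proof (rule induct)
      show "subspace {x. (\<Sum>i\<le>d. E i x) = x}"
        by (auto simp: subspace_def add scale zero sum.distrib scale_sum_right[symmetric])
      fix j v assume j: "j \<le> d" "v \<in> W j"
      have "(\<Sum>i\<le>d. E i v) = (\<Sum>i\<in>{j}. E i v)"
        using j E_W' by (intro sum.mono_neutral_right) auto
      then show "v \<in> {x. (\<Sum>i\<le>d. E i x) = x}"
        using E_W[OF j] by simp
    qed
    then show ?thesis by simp
  qed
  show "E i (E j x) = 0" if "i \<le> d" "j \<le> d" "i \<noteq> j" for i j x
    using E_W'[OF that E_in_W[OF that(2)]] .
  have range: "range (E i) = eigenspace A (t i)" if "i \<le> d" for i
  proof -
    have "range (E i) = W i"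
    proof
      show "range (E i) \<subseteq> W i"
        using E_in_W[OF that] by auto
      show "W i \<subseteq> range (E i)"
        using E_W[OF that] by (metis rangeI subsetI)
    qed
    then show ?thesis
      using t[OF that] by simp
  qed
  have th: "th i = t i" if "i \<le> d" for i
    unfolding th_def idempotent_eigenvalue_def
  proof (rule the_equality)
    show "range (E i) = eigenspace A (t i)"
      by (rule range[OF that])
    fix \<theta> assume "range (E i) = eigenspace A \<theta>"
    then show "\<theta> = t i"
      using range[OF that] t[OF that] eigenspace_inject[of A "t i" \<theta>] by simp
  qed
  show "A (E i x) = scale (th i) (E i x)" if "i \<le> d" for i x
    using range[OF that] th[OF that] by (auto simp: eigenspace_def)
  show "inj_on th {..d}"
  proof (rule inj_onI)
    fix i j assume ij: "i \<in> {..d}" "j \<in> {..d}" "th i = th j"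
    then have "W i = W j"
      using t[of i] t[of j] th by simp
    then show "i = j"
      using ij W_inj by simp
  qed
  show "E j (As (E i x)) = 0" if "i \<le> d" "j \<le> d" "i + 1 < j \<or> j + 1 < i" for i j x
  proof -
    let ?N = "{k. k \<le> d \<and> i \<le> k + 1 \<and> k \<le> i + 1}"
    have "As (E i x) \<in> span (\<Union>k\<in>?N. W k)"
      using ord E_in_W[OF that(1)] that(1) unfolding standard_ordering_def subspace_sum_def by blast
    moreover have "span (\<Union>k\<in>?N. W k) \<subseteq> {y. E j y = 0}"
    proof (rule span_minimal)
      show "subspace {y. E j y = 0}"
        using that(2) by (auto simp: subspace_def add scale zero)
      show "(\<Union>k\<in>?N. W k) \<subseteq> {y. E j y = 0}"
      proof
        fix y assume "y \<in> (\<Union>k\<in>?N. W k)"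
        then obtain k where "k \<in> ?N" "y \<in> W k"
          by blast
        then show "y \<in> {y. E j y = 0}"
          using E_W'[of j k y] that by auto
      qed
    qed
    ultimately show ?thesis by blast
  qed
  show "\<exists>x. E i x \<noteq> 0" if "i \<le> d" for i
  proof (rule ccontr)
    assume "\<nexists>x. E i x \<noteq> 0"
    then have "range (E i) = {0}"
      by auto
    then show False
      using range[OF that] t[OF that] by simp
  qed
qed

lemma td_system_tridiagonal_system:
  assumes "td_system d A E As Es"
  shows "tridiagonal_system scale Basis d A E (\<lambda>i. idempotent_eigenvalue A (E i))
    As Es (\<lambda>i. idempotent_eigenvalue As (Es i))"
proof -
  have A: "Vector_Spaces.linear scale scale A" and As: "Vector_Spaces.linear scale scale As"
    and "diagonalizable A" "diagonalizable As"
    and "standard_idempotents A As d E" "standard_idempotents As A d Es"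
    and irr: "\<not> (\<exists>W. subspace W \<and> A ` W \<subseteq> W \<and> As ` W \<subseteq> W \<and> W \<noteq> {0} \<and> W \<noteq> UNIV)"
    using assms by (auto simp: td_system_def td_pair_def)
  note E = standard_idempotents_facts[OF A As \<open>diagonalizable A\<close> \<open>standard_idempotents A As d E\<close>]
    and Es = standard_idempotents_facts[OF As A \<open>diagonalizable As\<close> \<open>standard_idempotents As A d Es\<close>]
  show ?thesis
  proof (rule tridiagonal_system.intro[OF finite_dimensional_vector_space_axioms
        tridiagonal_system_axioms.intro])
    show "W = {0} \<or> W = UNIV" if "subspace W" "A ` W \<subseteq> W" "As ` W \<subseteq> W" for W
      using irr that by blast
  qed (fact A As E Es)+
qed

end

section \<open>The module structure\<close>

theorem lemma8p1:
  fixes scale :: "'a::alg_closed_field \<Rightarrow> 'b::ab_group_add \<Rightarrow> 'b"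
    and Basis :: "'b set"
    and A As :: "'b \<Rightarrow> 'b"
    and E Es :: "nat \<Rightarrow> 'b \<Rightarrow> 'b"
    and d :: nat
    and q a b :: 'a
    and K B R Rd \<psi> :: "'b \<Rightarrow> 'b"
  assumes "td_space scale Basis"
    and "td_space.td_system scale d A E As Es"
    and "d \<ge> 1"
    and "td_space.q_racah_type scale d A E As Es q a b"
    and "td_space.weight_map scale q d (td_space.split_U scale d E Es) K"
    and "td_space.weight_map scale q d (td_space.split_U_down scale d E Es) B"
    and "R = td_space.raising_map scale A a K"
    and "Rd = td_space.raising_map scale A (inverse a) B"
    and "td_space.is_psi scale q d E Es K R \<psi>"
  shows "\<exists>act. td_space.uq_module scale q act \<and>
    act (uq_class q (free_gen Gen_e)) = (\<lambda>v. scale (inverse (q - inverse q)) (\<psi> v)) \<and>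
    act (uq_class q (free_gen Gen_f)) = (\<lambda>v. scale (inverse (q - inverse q)) (Rd v)) \<and>
    act (uq_class q (free_gen Gen_k)) = B \<and>
    act (uq_class q (free_gen Gen_kinv)) = inv_into UNIV B"
proof -
  interpret td_space scale Basis by fact
  let ?th = "\<lambda>i. idempotent_eigenvalue A (E i)"
  let ?ths = "\<lambda>i. idempotent_eigenvalue As (Es i)"
  interpret T: tridiagonal_system scale Basis d A E ?th As Es ?ths
    using assms(2) by (rule td_system_tridiagonal_system)
  have q: "q \<noteq> 0" "a \<noteq> 0" "q ^ 4 \<noteq> 1"
    and th: "\<And>i. i \<le> d \<Longrightarrow> ?th i = a * q powi (int d - 2 * int i) + inverse a * q powi (2 * int i - int d)"
    using assms(4) by (auto simp: q_racah_type_def)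
  have split_U: "split_U d E Es i = T.V i i" if "i \<le> d" for i
    using that unfolding split_U_def subspace_sum_def T.V_def
    by (subst T.span_ranges_E T.span_ranges_Es, force)+ auto
  have split_down: "split_U_down d E Es i
      = {x. (\<forall>h\<le>d. i < h \<longrightarrow> Es h x = 0) \<and> (\<forall>h\<le>d. d - i < h \<longrightarrow> E h x = 0)}" if "i \<le> d" for i
    using that unfolding split_U_down_def subspace_sum_def
    by (subst T.span_ranges_E T.span_ranges_Es, force)+ auto
  have split_K: "split_K d E Es i
      = {x. x \<in> T.V i i \<and> (\<forall>h\<le>d. d - i < h \<longrightarrow> E h x = 0)}" if "2 * i \<le> d" for i
    using that unfolding split_K_def subspace_sum_def T.V_def
    by (subst T.span_ranges_E T.span_ranges_Es, force)+ auto
  have K: "K v = scale (q powi (int d - 2 * int i)) v" if "i \<le> d" "v \<in> T.V i i" for i v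
    using assms(5) that by (auto simp: weight_map_def split_U)
  have linear_K: "Vector_Spaces.linear scale scale K"
    using assms(5) by (simp add: weight_map_def)
  have bij_K: "bij K"
    by (rule bij_if_weights[OF linear_K T.span_V_diagonal K]) (use q in simp_all)
  have psi: "Vector_Spaces.linear scale scale \<psi>"
    "\<And>v. \<psi> (R v) - R (\<psi> v) = scale (q - inverse q) (K v - inv_into UNIV K v)"
    "\<And>i v. 2 * i \<le> d \<Longrightarrow> v \<in> split_K d E Es i \<Longrightarrow> \<psi> v = 0"
    using assms(9) by (auto simp: is_psi_def)
  interpret D: double_lowering scale Basis d A E ?th As Es ?ths q a K "inv_into UNIV K" \<psi>
  proof (rule double_lowering.intro[OF T.tridiagonal_system_axioms double_lowering_axioms.intro])
    show "\<psi> (A v - scale a (K v) - scale (inverse a) (inv_into UNIV K v))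
        - (A (\<psi> v) - scale a (K (\<psi> v)) - scale (inverse a) (inv_into UNIV K (\<psi> v)))
      = scale (q - inverse q) (K v - inv_into UNIV K v)" for v
      using psi(2)[of v] by (simp add: assms(7) raising_map_def)
    show "\<psi> v = 0" if "2 * i \<le> d" "v \<in> T.V i i" "\<And>h. h \<le> d \<Longrightarrow> d - i < h \<Longrightarrow> E h v = 0" for i v
      using psi(3)[OF that(1)] that by (simp add: split_K)
    show "K (inv_into UNIV K v) = v" "inv_into UNIV K (K v) = v" for v
      using bij_K by (simp_all add: bij_def surj_f_inv_f)
  qed (fact q(1) q(2) th linear_K K psi(1))+
  have B: "B = D.C"
    using assms(6) by (intro D.weight_map_unique) (auto simp: weight_map_def split_down)
  have Ci: "inv_into UNIV B = D.Ci"
    by (simp add: B D.Ci_def)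
  have Rd: "Rd = D.Rd"
    by (simp add: assms(8) raising_map_def fun_eq_iff B Ci[unfolded B] D.Rd_def)
  have s: "D.s \<noteq> 0"
  proof
    assume "D.s = 0"
    then have "q * q = 1"
      using q by (simp add: D.s_def field_simps)
    then have "q ^ 4 = 1"
      by (simp add: power4_eq_xxxx mult.assoc)
    then show False
      using q by simp
  qed
  interpret Rd: Vector_Spaces.linear scale scale D.Rd
    by (rule D.linear_Rd)
  show ?thesis
    unfolding B Ci[unfolded B] Rd D.s_def[symmetric]
  proof (rule uq_module_of_relations)
    show "Vector_Spaces.linear scale scale (\<lambda>v. scale (inverse D.s) (\<psi> v))"
      by unfold_locales (simp_all add: D.psi.add D.psi.scale scale_right_distrib mult.commute)
    show "Vector_Spaces.linear scale scale (\<lambda>v. scale (inverse D.s) (D.Rd v))"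
      by unfold_locales (simp_all add: Rd.add Rd.scale scale_right_distrib mult.commute)
    show "scale (inverse D.s) (\<psi> (scale (inverse D.s) (D.Rd v)))
        - scale (inverse D.s) (D.Rd (scale (inverse D.s) (\<psi> v)))
      = scale (inverse (q - inverse q)) (D.C v - D.Ci v)" for v
    proof -
      have "scale (inverse D.s) (\<psi> (scale (inverse D.s) (D.Rd v)))
          - scale (inverse D.s) (D.Rd (scale (inverse D.s) (\<psi> v)))
        = scale (inverse D.s * inverse D.s) (\<psi> (D.Rd v) - D.Rd (\<psi> v))"
        by (simp add: D.psi.scale Rd.scale scale_right_diff_distrib)
      then show ?thesis
        using s by (simp add: D.psi_Rd D.s_def[symmetric])
    qed
  qed (simp_all add: D.linear_C D.linear_Ci D.C.scale D.C_psi D.C_Rd mult.commute)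
qed

end
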